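(* Let $T>0$, $\Omega=(0,1)\times(0,1)$, $g\in L^1(\Omega)$, and let $\varphi\in L^1(0,T)$ satisfy condition (H). Then the system $$\begin{cases} u_t-\Delta u=\varphi(t)f(x,y), & (x,y)\in\Omega,\ t\in(0,T),\\ u_x(0,y,t)=u_x(1,y,t)=u_y(x,0,t)=u_y(x,1,t)=0,\\ u(1,y,t)=0,\\ u(x,y,0)=g(x,y),\end{cases}$$ has at most one solution $(u,f)$ in $\big(C^1([0,T];L^1(\Omega))\cap L^2(0,T;H^2(\Omega))\big)\times L^2(\Omega)$.
   Context: Condition (H) on $\varphi\in L^1(0,T)$: there exist $T_0\in(0,T]$, $\theta\ge 0$ and $\Lambda>0$ such that either $\varphi(t)\ge\Lambda t^\theta$ for a.e. $t\in(0,T_0)$, or $\varphi(t)\le-\Lambda t^\theta$ for a.e. $t\in(0,T_0)$. *)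

theory Defs
  imports "HOL-Analysis.Analysis"
begin

definition Omega :: "(real \<times> real) set" where
  "Omega = {0<..<1} \<times> {0<..<1}"

definition L1_on :: "'a::euclidean_space set \<Rightarrow> ('a \<Rightarrow> real) \<Rightarrow> bool" where
  "L1_on S f \<longleftrightarrow> set_integrable lebesgue S f"

definition L2_on :: "'a::euclidean_space set \<Rightarrow> ('a \<Rightarrow> real) \<Rightarrow> bool" where
  "L2_on S f \<longleftrightarrow> f \<in> borel_measurable (lebesgue_on S) \<and> set_integrable lebesgue S (\<lambda>x. (f x)^2)"

definition L1_norm :: "((real \<times> real) \<Rightarrow> real) \<Rightarrow> real" where
  "L1_norm v = set_lebesgue_integral lebesgue Omega (\<lambda>p. \<bar>v p\<bar>)"

definition test_fun :: "((real \<times> real) \<Rightarrow> real) \<Rightarrow> ((real \<times> real) \<Rightarrow> real) \<Rightarrow> ((real \<times> real) \<Rightarrow> real) \<Rightarrow> bool" where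
  "test_fun phi phix phiy \<longleftrightarrow>
     (\<forall>p. (phi has_derivative (\<lambda>h. fst h * phix p + snd h * phiy p)) (at p)) \<and>
     continuous_on UNIV phix \<and> continuous_on UNIV phiy \<and>
     compact (closure {p. phi p \<noteq> 0}) \<and> closure {p. phi p \<noteq> 0} \<subseteq> Omega"

definition weak_dx :: "((real \<times> real) \<Rightarrow> real) \<Rightarrow> ((real \<times> real) \<Rightarrow> real) \<Rightarrow> bool" where
  "weak_dx v w \<longleftrightarrow> (\<forall>phi phix phiy. test_fun phi phix phiy \<longrightarrow>
     set_lebesgue_integral lebesgue Omega (\<lambda>p. v p * phix p) =
     - set_lebesgue_integral lebesgue Omega (\<lambda>p. w p * phi p))"

definition weak_dy :: "((real \<times> real) \<Rightarrow> real) \<Rightarrow> ((real \<times> real) \<Rightarrow> real) \<Rightarrow> bool" where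
  "weak_dy v w \<longleftrightarrow> (\<forall>phi phix phiy. test_fun phi phix phiy \<longrightarrow>
     set_lebesgue_integral lebesgue Omega (\<lambda>p. v p * phiy p) =
     - set_lebesgue_integral lebesgue Omega (\<lambda>p. w p * phi p))"

definition in_H1 :: "((real \<times> real) \<Rightarrow> real) \<Rightarrow> ((real \<times> real) \<Rightarrow> real) \<Rightarrow> ((real \<times> real) \<Rightarrow> real) \<Rightarrow> bool" where
  "in_H1 v vx vy \<longleftrightarrow> L2_on Omega v \<and> L2_on Omega vx \<and> L2_on Omega vy \<and> weak_dx v vx \<and> weak_dy v vy"

definition in_H2 :: "((real \<times> real) \<Rightarrow> real) \<Rightarrow> ((real \<times> real) \<Rightarrow> real) \<Rightarrow> ((real \<times> real) \<Rightarrow> real) \<Rightarrow>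
    ((real \<times> real) \<Rightarrow> real) \<Rightarrow> ((real \<times> real) \<Rightarrow> real) \<Rightarrow> ((real \<times> real) \<Rightarrow> real) \<Rightarrow> ((real \<times> real) \<Rightarrow> real) \<Rightarrow> bool" where
  "in_H2 v vx vy vxx vxy vyx vyy \<longleftrightarrow> in_H1 v vx vy \<and> in_H1 vx vxx vxy \<and> in_H1 vy vyx vyy"

text \<open>Vanishing boundary traces on the four sides of Omega.  For w in H^1(Omega) the map
  s \<mapsto> w(s,.) is continuous into L^1(0,1) up to s = 0, with value the trace; hence the trace on
  {x=0} vanishes iff the averaged L^1 mass of w over the strip (0,s) x (0,1) tends to 0.
  This formulation is independent of the chosen a.e. representative.\<close>
definition trace0_x0 :: "((real \<times> real) \<Rightarrow> real) \<Rightarrow> bool" where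
  "trace0_x0 w \<longleftrightarrow> ((\<lambda>s. (1 / s) * set_lebesgue_integral lebesgue ({0<..<s} \<times> {0<..<1}) (\<lambda>p. \<bar>w p\<bar>)) \<longlongrightarrow> 0) (at_right 0)"

definition trace0_x1 :: "((real \<times> real) \<Rightarrow> real) \<Rightarrow> bool" where
  "trace0_x1 w \<longleftrightarrow> ((\<lambda>s. (1 / s) * set_lebesgue_integral lebesgue ({1-s<..<1} \<times> {0<..<1}) (\<lambda>p. \<bar>w p\<bar>)) \<longlongrightarrow> 0) (at_right 0)"

definition trace0_y0 :: "((real \<times> real) \<Rightarrow> real) \<Rightarrow> bool" where
  "trace0_y0 w \<longleftrightarrow> ((\<lambda>s. (1 / s) * set_lebesgue_integral lebesgue ({0<..<1} \<times> {0<..<s}) (\<lambda>p. \<bar>w p\<bar>)) \<longlongrightarrow> 0) (at_right 0)"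

definition trace0_y1 :: "((real \<times> real) \<Rightarrow> real) \<Rightarrow> bool" where
  "trace0_y1 w \<longleftrightarrow> ((\<lambda>s. (1 / s) * set_lebesgue_integral lebesgue ({0<..<1} \<times> {1-s<..<1}) (\<lambda>p. \<bar>w p\<bar>)) \<longlongrightarrow> 0) (at_right 0)"

definition C1_L1 :: "real \<Rightarrow> (real \<Rightarrow> (real \<times> real) \<Rightarrow> real) \<Rightarrow> (real \<Rightarrow> (real \<times> real) \<Rightarrow> real) \<Rightarrow> bool" where
  "C1_L1 T u u' \<longleftrightarrow>
     (\<forall>t\<in>{0..T}. L1_on Omega (u t) \<and> L1_on Omega (u' t)) \<and>
     (\<forall>t\<in>{0..T}. ((\<lambda>s. L1_norm (\<lambda>p. (u s p - u t p) / (s - t) - u' t p)) \<longlongrightarrow> 0) (at t within {0..T})) \<and>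
     (\<forall>t\<in>{0..T}. ((\<lambda>s. L1_norm (\<lambda>p. u' s p - u' t p)) \<longlongrightarrow> 0) (at t within {0..T}))"

definition L2_H2 :: "real \<Rightarrow> (real \<Rightarrow> (real \<times> real) \<Rightarrow> real) \<Rightarrow> (real \<Rightarrow> (real \<times> real) \<Rightarrow> real) \<Rightarrow>
    (real \<Rightarrow> (real \<times> real) \<Rightarrow> real) \<Rightarrow> (real \<Rightarrow> (real \<times> real) \<Rightarrow> real) \<Rightarrow> (real \<Rightarrow> (real \<times> real) \<Rightarrow> real) \<Rightarrow>
    (real \<Rightarrow> (real \<times> real) \<Rightarrow> real) \<Rightarrow> (real \<Rightarrow> (real \<times> real) \<Rightarrow> real) \<Rightarrow> bool" where
  "L2_H2 T u ux uy uxx uxy uyx uyy \<longleftrightarrow>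
     (\<forall>w\<in>{u, ux, uy, uxx, uxy, uyx, uyy}. L2_on ({0<..<T} \<times> Omega) (\<lambda>(t, p). w t p)) \<and>
     (AE t in lebesgue. t \<in> {0<..<T} \<longrightarrow> in_H2 (u t) (ux t) (uy t) (uxx t) (uxy t) (uyx t) (uyy t))"

definition cond_H :: "real \<Rightarrow> (real \<Rightarrow> real) \<Rightarrow> bool" where
  "cond_H T phi \<longleftrightarrow> (\<exists>T0 \<theta> \<Lambda>. 0 < T0 \<and> T0 \<le> T \<and> \<theta> \<ge> 0 \<and> \<Lambda> > 0 \<and>
     ((AE t in lebesgue. t \<in> {0<..<T0} \<longrightarrow> phi t \<ge> \<Lambda> * t powr \<theta>) \<or>
      (AE t in lebesgue. t \<in> {0<..<T0} \<longrightarrow> phi t \<le> - \<Lambda> * t powr \<theta>)))"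

definition is_solution :: "real \<Rightarrow> (real \<Rightarrow> real) \<Rightarrow> ((real \<times> real) \<Rightarrow> real) \<Rightarrow>
    (real \<Rightarrow> (real \<times> real) \<Rightarrow> real) \<Rightarrow> ((real \<times> real) \<Rightarrow> real) \<Rightarrow> bool" where
  "is_solution T phi g u f \<longleftrightarrow> L2_on Omega f \<and>
     (\<exists>u' ux uy uxx uxy uyx uyy.
        C1_L1 T u u' \<and> L2_H2 T u ux uy uxx uxy uyx uyy \<and>
        (AE t in lebesgue. t \<in> {0<..<T} \<longrightarrow>
           (AE p in lebesgue. p \<in> Omega \<longrightarrow> u' t p - (uxx t p + uyy t p) = phi t * f p)) \<and>
        (AE t in lebesgue. t \<in> {0<..<T} \<longrightarrow>
           trace0_x0 (ux t) \<and> trace0_x1 (ux t) \<and> trace0_y0 (uy t) \<and> trace0_y1 (uy t) \<and>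
           trace0_x1 (u t)) \<and>
        (AE p in lebesgue. p \<in> Omega \<longrightarrow> u 0 p = g p))"

end

theory Submission
  imports Defs
begin

text \<open>
  Let \<open>w = cosh (a x) cos (n \<pi> y)\<close> and \<open>\<lambda> = a\<^sup>2 - (n \<pi>)\<^sup>2\<close>, so that \<open>\<Delta> w = \<lambda> w\<close>, \<open>w\<^sub>x = 0\<close> at \<open>x = 0\<close> and
  \<open>w\<^sub>y = 0\<close> at \<open>y = 0, 1\<close>; since both \<open>u\<close> and \<open>u\<^sub>x\<close> vanish at \<open>x = 1\<close>, every \<open>a\<close> is allowed. Testing the
  difference \<open>(u, f)\<close> of two solutions with \<open>w\<close> gives
  \<open>e\<^bsup>-\<lambda>t\<^esup> \<integral>u(t) w = (\<integral>f w) (\<integral>\<^sub>0\<^sup>t e\<^bsup>-\<lambda>s\<^esup> \<phi>(s) ds)\<close>. At \<open>t = T\<close>, condition (H) bounds the last factor from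
  below by a multiple of \<open>e\<^bsup>-\<lambda>T/2\<^esup>\<close>, so \<open>\<integral>f w\<close> decays like a Gaussian in \<open>a\<close>. Mikusinski's moment
  argument, summing \<open>(-1)\<^bsup>k-1\<^esup> e\<^bsup>-kNt\<^esup> cosh (k N x) / k!\<close> over \<open>k \<ge> 1\<close> and letting \<open>N \<rightarrow> \<infinity>\<close>, turns this decay
  into the vanishing of \<open>\<integral>f cos (n \<pi> y)\<close> over \<open>{x > t}\<close> for all \<open>t\<close> and \<open>n\<close>, whence \<open>f = 0\<close>. The same
  identity at arbitrary \<open>t\<close> then gives \<open>u(t) = 0\<close>.
\<close>

section \<open>Integration against bounded weights\<close>

text \<open>Condition (H) speaks of \<open>phi\<close> only near \<open>t = 0\<close>, and the
  factor \<open>exp (- lam * s)\<close> singles out small \<open>s\<close> only when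
  \<open>lam\<close> is large and positive. With the Neumann conditions alone the admissible weights
  are cosines in \<open>x\<close>, for which \<open>lam\<close> is nonpositive; the extra condition
  \<open>u = 0\<close> on \<open>x = 1\<close> admits real \<open>a\<close>, hence
  \<open>lam\<close> of order \<open>a^2\<close>. The condition at \<open>x = 0\<close> still forces
  weights even in \<open>x\<close>, so the moments carry \<open>cosh\<close> where the classical
  kernel has exponentials, and that kernel has to be symmetrized. The Laplace integral of
  \<open>phi\<close> may decay at any exponential rate slower than \<open>exp (- lam * T)\<close>, a
  factor that the other side carries already; \<open>T / 2\<close> is a convenient choice. The
  weight costs only \<open>exp a\<close>, and of the Gaussian decay only \<open>exp (- a)\<close> is
  passed on. The main analytic obstacle is Green's formula: traces are given as averages over thin
  strips and weak derivatives through compactly supported test functions, so it is reached through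
  cutoffs whose derivatives live on exactly those strips.\<close>

lemma set_integrable_mult_bounded:
  fixes g w :: "'a \<Rightarrow> real"
  assumes g: "set_integrable M A g" and A: "A \<in> sets M" and w: "w \<in> borel_measurable M"
    and bd: "\<And>x. x \<in> A \<Longrightarrow> \<bar>w x\<bar> \<le> B"
  shows "set_integrable M A (\<lambda>x. g x * w x)"
proof -
  have [measurable]: "(\<lambda>x. indicat_real A x * g x) \<in> borel_measurable M"
    using g unfolding set_integrable_def by (simp add: borel_measurable_integrable)
  note w[measurable]
  have i: "integrable M (\<lambda>x. B * (indicat_real A x * g x))"
    using g unfolding set_integrable_def by simp
  have "integrable M (\<lambda>x. (indicat_real A x * g x) * w x)"
  proof (rule Bochner_Integration.integrable_bound[OF i])
    show "AE x in M. norm (indicat_real A x * g x * w x) \<le> norm (B * (indicat_real A x * g x))"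
    proof (rule AE_I2)
      fix x
      have "x \<in> A \<Longrightarrow> \<bar>g x\<bar> * \<bar>w x\<bar> \<le> \<bar>B\<bar> * \<bar>g x\<bar>"
        using bd[of x] by (smt (verit) mult.commute mult_left_mono abs_ge_zero)
      then show "norm (indicat_real A x * g x * w x) \<le> norm (B * (indicat_real A x * g x))"
        by (cases "x \<in> A") (auto simp: abs_mult)
    qed
  qed measurable
  then show ?thesis
    unfolding set_integrable_def by (simp add: mult.assoc)
qed

lemma set_integral_abs_bound: "\<bar>LINT x:A|M. f x\<bar> \<le> (LINT x:A|M. \<bar>f x\<bar>)" for f :: "'a \<Rightarrow> real"
  using integral_norm_bound[of M "\<lambda>x. indicat_real A x *\<^sub>R f x"]
  unfolding set_lebesgue_integral_def by (simp add: abs_mult)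

lemma set_integral_mult_bounded:
  fixes g w :: "'a \<Rightarrow> real"
  assumes g: "set_integrable M A g" and A: "A \<in> sets M" and w: "w \<in> borel_measurable M"
    and bd: "\<And>x. x \<in> A \<Longrightarrow> \<bar>w x\<bar> \<le> B"
  shows "\<bar>LINT x:A|M. g x * w x\<bar> \<le> B * (LINT x:A|M. \<bar>g x\<bar>)"
proof -
  note i = set_integrable_mult_bounded[OF assms]
  have "\<bar>LINT x:A|M. g x * w x\<bar> \<le> (LINT x:A|M. \<bar>g x * w x\<bar>)"
    by (rule set_integral_abs_bound)
  also have "\<dots> \<le> (LINT x:A|M. \<bar>g x\<bar> * B)"
    using g i bd by (intro set_integral_mono set_integrable_abs set_integrable_mult_left)
      (auto simp: abs_mult mult_left_mono)
  finally show ?thesis by (simp add: mult.commute)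
qed

text \<open>Dominated convergence with majorant \<open>|B| |g|\<close>. The limit is asked for only
  almost everywhere because the Mikusinski kernel has a different limit on one vertical
  line.\<close>

lemma set_integral_mult_tendsto:
  fixes g w :: "'a \<Rightarrow> real"
  assumes g: "set_integrable M A g" and A: "A \<in> sets M"
    and wk: "\<And>k. wk k \<in> borel_measurable M" and w: "w \<in> borel_measurable M"
    and bd: "\<And>k x. x \<in> A \<Longrightarrow> \<bar>wk k x\<bar> \<le> B"
    and lim: "AE x in M. x \<in> A \<longrightarrow> (\<lambda>k. wk k x) \<longlonglongrightarrow> w x"
  shows "(\<lambda>k. LINT x:A|M. g x * wk k x) \<longlonglongrightarrow> (LINT x:A|M. g x * w x)"
proof -
  have [measurable]: "(\<lambda>x. indicat_real A x * g x) \<in> borel_measurable M"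
    using g unfolding set_integrable_def by (simp add: borel_measurable_integrable)
  note wk[measurable] w[measurable]
  have i: "integrable M (\<lambda>x. \<bar>B\<bar> * \<bar>indicat_real A x * g x\<bar>)"
    using g unfolding set_integrable_def by (simp add: integrable_abs del: abs_mult)
  have "(\<lambda>k. \<integral>x. (indicat_real A x * g x) * wk k x \<partial>M) \<longlonglongrightarrow> (\<integral>x. (indicat_real A x * g x) * w x \<partial>M)"
  proof (rule integral_dominated_convergence[OF _ _ i])
    show "AE x in M. (\<lambda>k. indicat_real A x * g x * wk k x) \<longlonglongrightarrow> indicat_real A x * g x * w x"
      using lim
    proof eventually_elim
      case (elim x)
      then show ?case by (cases "x \<in> A") (auto intro: tendsto_mult_left)
    qed
    show "AE x in M. norm (indicat_real A x * g x * wk k x) \<le> \<bar>B\<bar> * \<bar>indicat_real A x * g x\<bar>" for k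
    proof (rule AE_I2)
      fix x
      have "x \<in> A \<Longrightarrow> \<bar>g x\<bar> * \<bar>wk k x\<bar> \<le> \<bar>B\<bar> * \<bar>g x\<bar>"
        using bd[of x k] by (smt (verit) mult.commute mult_left_mono abs_ge_zero)
      then show "norm (indicat_real A x * g x * wk k x) \<le> \<bar>B\<bar> * \<bar>indicat_real A x * g x\<bar>"
        by (cases "x \<in> A") (auto simp: abs_mult)
    qed
  qed measurable
  then show ?thesis
    unfolding set_lebesgue_integral_def by (simp add: mult.assoc)
qed

lemma set_integral_sum:
  fixes f :: "'i \<Rightarrow> 'a \<Rightarrow> real"
  assumes "\<And>i. i \<in> I \<Longrightarrow> set_integrable M A (f i)"
  shows "(LINT x:A|M. (\<Sum>i\<in>I. f i x)) = (\<Sum>i\<in>I. LINT x:A|M. f i x)"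
  using assms unfolding set_lebesgue_integral_def set_integrable_def scaleR_sum_right
  by (rule Bochner_Integration.integral_sum)

lemma borel_measurable_lebesgueI:
  fixes w :: "'a::euclidean_space \<Rightarrow> real"
  shows "w \<in> borel_measurable borel \<Longrightarrow> w \<in> borel_measurable lebesgue"
  by (simp add: measurable_completion)

lemma Omega_sets: "Omega \<in> sets lebesgue"
proof -
  have "open Omega" unfolding Omega_def by (intro open_Times open_greaterThanLessThan)
  then show ?thesis by simp
qed

text \<open>For \<open>t > 0\<close> the Mikusinski kernel tends to \<open>(1 - 1/e) / 2\<close> at
  \<open>x = t\<close>, which is neither \<open>0\<close> nor \<open>1/2\<close>; this line is
  discarded when \<open>N\<close> tends to infinity.\<close>

lemma AE_lebesgue_fst_neq: "AE p :: real \<times> real in lebesgue. fst p \<noteq> t"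
proof -
  have "negligible {p :: real \<times> real. p \<bullet> (1,0) = t}"
    by (rule negligible_standard_hyperplane) (simp add: Basis_prod_def)
  then have "{p :: real \<times> real. fst p = t} \<in> null_sets lebesgue"
    by (simp add: negligible_iff_null_sets inner_prod_def)
  then show ?thesis
    by (rule AE_I') auto
qed

section \<open>Uniqueness from small moments\<close>

lemma cosh_le_exp: "\<bar>x\<bar> \<le> y \<Longrightarrow> cosh x \<le> exp y" for x y :: real
proof -
  assume "\<bar>x\<bar> \<le> y"
  then have "exp x \<le> exp y" "exp (-x) \<le> exp y" by auto
  then have "exp x + exp (-x) \<le> 2 * exp y" by linarith
  then show ?thesis by (simp add: cosh_def)
qed

text \<open>For \<open>x > 0\<close> the symmetrized Mikusinski kernel tends to half the indicator of \<open>{t<..}\<close> as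
  \<open>N \<rightarrow> \<infinity>\<close>; being even in \<open>x\<close>, it expands in \<open>cosh (k N x)\<close>.\<close>
definition mikusinski_coeff :: "real \<Rightarrow> nat \<Rightarrow> real" where
  "mikusinski_coeff s k = - ((-1) ^ Suc k) * exp (- (real (Suc k) * s)) / fact (Suc k)"

definition mikusinski_kernel :: "real \<Rightarrow> real \<Rightarrow> real \<Rightarrow> real" where
  "mikusinski_kernel N t x = (2 - exp (- exp (N * (x - t))) - exp (- exp (N * (- x - t)))) / 2"

text \<open>Average \<open>1 - exp (- z)\<close> over \<open>z = exp (N * (x - t))\<close> and
  \<open>z = exp (N * (- x - t))\<close>: the powers of equal order pair into a \<open>cosh\<close>.
  The constant term of the exponential series has to go, since smallness of the moments for large
  \<open>a\<close> says nothing about the moment at \<open>a = 0\<close>.\<close>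

lemma mikusinski_kernel_sums:
  "(\<lambda>k. mikusinski_coeff (N * t) k * cosh (real (Suc k) * N * x)) sums mikusinski_kernel N t x"
proof -
  have e: "(\<lambda>k. (- z) ^ Suc k / fact (Suc k)) sums (exp (- z) - 1)" for z :: real
    using exp_converges[of "-z"] by (subst sums_Suc_iff) (simp add: divide_inverse mult.commute)
  have *: "(\<lambda>k. (- ((- exp (N * (x - t))) ^ Suc k / fact (Suc k)) - (- exp (N * (- x - t))) ^ Suc k / fact (Suc k)) / 2)
     sums ((- (exp (- exp (N * (x - t))) - 1) - (exp (- exp (N * (- x - t))) - 1)) / 2)"
    by (intro sums_divide sums_diff sums_minus e)
  have pw: "(- exp (N * y)) ^ Suc k = (-1) ^ Suc k * exp (real (Suc k) * (N * y))" for y k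
    by (subst power_minus) (simp only: exp_of_nat_mult)
  have "(- ((- exp (N * (x - t))) ^ Suc k / fact (Suc k)) - (- exp (N * (- x - t))) ^ Suc k / fact (Suc k)) / 2
     = mikusinski_coeff (N * t) k * cosh (real (Suc k) * N * x)" for k
  proof -
    have 1: "exp (real (Suc k) * (N * (x - t))) = exp (- (real (Suc k) * (N * t))) * exp (real (Suc k) * N * x)"
      unfolding mult_exp_exp by (rule arg_cong[where f=exp]) (simp only: algebra_simps)
    have 2: "exp (real (Suc k) * (N * (- x - t))) = exp (- (real (Suc k) * (N * t))) * exp (- (real (Suc k) * N * x))"
      unfolding mult_exp_exp by (rule arg_cong[where f=exp]) (simp only: algebra_simps)
    show ?thesis
      unfolding pw mikusinski_coeff_def cosh_def 1 2 by (simp add: field_simps del: fact_Suc power_Suc of_nat_Suc)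
  qed
  with * show ?thesis
    by (simp add: mikusinski_kernel_def algebra_simps del: fact_Suc power_Suc of_nat_Suc)
qed

lemma mikusinski_coeff_bound:
  assumes "s \<ge> 0" shows "\<bar>mikusinski_coeff s k\<bar> \<le> 1 / fact (Suc k)"
proof -
  have "exp (- (real (Suc k) * s)) \<le> 1" using assms by (simp del: of_nat_Suc)
  moreover have "\<bar>mikusinski_coeff s k\<bar> = exp (- (real (Suc k) * s)) / fact (Suc k)"
    by (simp add: mikusinski_coeff_def abs_mult power_abs del: fact_Suc of_nat_Suc)
  ultimately show ?thesis by (simp add: divide_right_mono del: fact_Suc of_nat_Suc)
qed

text \<open>Serves twice: \<open>z = exp N\<close> dominates the partial sums of the kernel on
  \<open>Omega\<close>, and \<open>z = exp (- N)\<close> bounds them after integration.\<close>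

lemma sum_exp_tail_le:
  assumes "z \<ge> (0::real)" shows "(\<Sum>k<K. z ^ Suc k / fact (Suc k)) \<le> exp z - 1"
proof -
  have s: "(\<lambda>k. z ^ Suc k / fact (Suc k)) sums (exp z - 1)"
    using exp_converges[of z] by (subst sums_Suc_iff) (simp add: divide_inverse mult.commute)
  show ?thesis
    unfolding sums_unique[OF s] by (rule sum_le_suminf) (use s assms in \<open>auto simp: sums_iff\<close>)
qed

text \<open>For \<open>x > 0\<close> and \<open>t \<ge> 0\<close> the reflected exponent
  \<open>- x - t\<close> is negative, so its term always tends to 1 and only the sign of
  \<open>x - t\<close> decides.\<close>

lemma mikusinski_kernel_tendsto:
  assumes "x > 0" "t \<ge> 0" "x \<noteq> t"
  shows "(\<lambda>N. mikusinski_kernel (real N) t x) \<longlonglongrightarrow> (if t < x then 1 else 0) / 2"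
proof -
  have neg: "(\<lambda>N. exp (- exp (real N * y))) \<longlonglongrightarrow> 1" if "y < 0" for y :: real
  proof -
    have "(\<lambda>N. exp (real N * y)) \<longlonglongrightarrow> 0"
      using filterlim_tendsto_neg_mult_at_bot[OF tendsto_const that filterlim_real_sequentially]
      by (intro filterlim_compose[OF exp_at_bot]) (simp add: mult.commute)
    then have "(\<lambda>N. exp (- exp (real N * y))) \<longlonglongrightarrow> exp (- 0)" by (intro tendsto_intros)
    then show ?thesis by simp
  qed
  have pos: "(\<lambda>N. exp (- exp (real N * y))) \<longlonglongrightarrow> 0" if "y > 0" for y :: real
  proof -
    have "filterlim (\<lambda>N. real N * y) at_top sequentially"
      using that by (intro filterlim_at_top_mult_tendsto_pos[where c=y] tendsto_const filterlim_real_sequentially)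
    then have "filterlim (\<lambda>N. exp (real N * y)) at_top sequentially"
      by (rule filterlim_compose[OF exp_at_top])
    then show ?thesis
      by (intro filterlim_compose[OF exp_at_bot]) (simp add: filterlim_uminus_at_top)
  qed
  have 2: "(\<lambda>N. exp (- exp (real N * (- x - t)))) \<longlonglongrightarrow> 1" using assms by (intro neg) auto
  have 1: "(\<lambda>N. exp (- exp (real N * (x - t)))) \<longlonglongrightarrow> (if t < x then 0 else 1)"
    using assms pos[of "x - t"] neg[of "x - t"] by auto
  have "(\<lambda>N. mikusinski_kernel (real N) t x) \<longlonglongrightarrow> (2 - (if t < x then 0 else 1) - 1) / 2"
    unfolding mikusinski_kernel_def by (intro tendsto_intros 1 2) auto
  then show ?thesis by (auto split: if_splits)
qed

text \<open>For fixed \<open>N\<close> the kernel series is integrated term by term. The moment at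
  \<open>a = k N\<close> is at most \<open>exp (- k N)\<close> and its coefficient at most
  \<open>1 / k!\<close>, so the integral of \<open>g\<close> against the kernel is at most
  \<open>exp (exp (- N)) - 1\<close>, which tends to 0; the same integral tends to half of the one
  in question.\<close>

lemma cosh_moments_small_imp_zero:
  fixes g :: "real \<times> real \<Rightarrow> real"
  assumes g: "set_integrable lebesgue Omega g"
    and small: "\<forall>\<^sub>F a in at_top. \<bar>LINT p:Omega|lebesgue. g p * cosh (a * fst p)\<bar> \<le> exp (- a)"
    and t: "t \<ge> 0"
  shows "(LINT p:Omega|lebesgue. g p * indicator {t<..} (fst p)) = 0"
proof -
  obtain a0 where a0: "\<And>a. a \<ge> a0 \<Longrightarrow> \<bar>LINT p:Omega|lebesgue. g p * cosh (a * fst p)\<bar> \<le> exp (- a)"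
    using small unfolding eventually_at_top_linorder by blast
  have meas_cosh: "(\<lambda>p::real\<times>real. cosh (a * fst p)) \<in> borel_measurable lebesgue" for a
    by (intro borel_measurable_lebesgueI borel_measurable_continuous_onI continuous_intros)
  have in01: "0 < fst p" "fst p < 1" if "p \<in> Omega" for p
    using that by (auto simp: Omega_def)
  have kernel_bound: "\<bar>LINT p:Omega|lebesgue. g p * mikusinski_kernel (real N) t (fst p)\<bar> \<le> exp (exp (- real N)) - 1"
    if N: "real N \<ge> a0" for N
  proof -
    define wk where "wk = (\<lambda>K (p::real\<times>real). \<Sum>k<K. mikusinski_coeff (real N * t) k * cosh (real (Suc k) * real N * fst p))"
    have lim: "(\<lambda>K. LINT p:Omega|lebesgue. g p * wk K p) \<longlonglongrightarrow> (LINT p:Omega|lebesgue. g p * mikusinski_kernel (real N) t (fst p))"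
    proof (rule set_integral_mult_tendsto[OF g Omega_sets])
      show "wk K \<in> borel_measurable lebesgue" for K
        unfolding wk_def by (intro borel_measurable_sum borel_measurable_times meas_cosh borel_measurable_const)
      show "(\<lambda>p. mikusinski_kernel (real N) t (fst p)) \<in> borel_measurable lebesgue"
        unfolding mikusinski_kernel_def
        by (intro borel_measurable_lebesgueI borel_measurable_continuous_onI continuous_intros) auto
      show "AE p in lebesgue. p \<in> Omega \<longrightarrow> (\<lambda>K. wk K p) \<longlonglongrightarrow> mikusinski_kernel (real N) t (fst p)"
        using mikusinski_kernel_sums unfolding wk_def sums_def by auto
      show "\<bar>wk K p\<bar> \<le> exp (exp (real N)) - 1" if "p \<in> Omega" for K p
      proof -
        have "\<bar>wk K p\<bar> \<le> (\<Sum>k<K. \<bar>mikusinski_coeff (real N * t) k * cosh (real (Suc k) * real N * fst p)\<bar>)"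
          unfolding wk_def by (rule sum_abs)
        also have "\<dots> \<le> (\<Sum>k<K. exp (real N) ^ Suc k / fact (Suc k))"
        proof (rule sum_mono)
          fix k
          have "\<bar>real (Suc k) * real N * fst p\<bar> \<le> real (Suc k) * real N"
            using in01[OF that] by (simp add: abs_mult mult_left_le del: of_nat_Suc)
          from cosh_le_exp[OF this] have 1: "cosh (real (Suc k) * real N * fst p) \<le> exp (real N) ^ Suc k"
            by (simp only: exp_of_nat_mult)
          have 2: "\<bar>mikusinski_coeff (real N * t) k\<bar> \<le> 1 / fact (Suc k)"
            using t by (intro mikusinski_coeff_bound) auto
          have "\<bar>mikusinski_coeff (real N * t) k\<bar> * cosh (real (Suc k) * real N * fst p) \<le> 1 / fact (Suc k) * exp (real N) ^ Suc k"
            by (intro mult_mono 1 2) (auto simp: cosh_real_nonneg)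
          then show "\<bar>mikusinski_coeff (real N * t) k * cosh (real (Suc k) * real N * fst p)\<bar> \<le> exp (real N) ^ Suc k / fact (Suc k)"
            by (simp add: abs_mult cosh_real_nonneg del: fact_Suc of_nat_Suc power_Suc)
        qed
        also have "\<dots> \<le> exp (exp (real N)) - 1" by (rule sum_exp_tail_le) simp
        finally show ?thesis .
      qed
    qed
    have "\<bar>LINT p:Omega|lebesgue. g p * wk K p\<bar> \<le> exp (exp (- real N)) - 1" for K
    proof -
      have intg: "set_integrable lebesgue Omega (\<lambda>p. g p * cosh (a * fst p))" for a
      proof (rule set_integrable_mult_bounded[OF g Omega_sets meas_cosh])
        show "\<bar>cosh (a * fst p)\<bar> \<le> exp \<bar>a\<bar>" if "p \<in> Omega" for p
          using in01[OF that] by (simp add: cosh_real_nonneg cosh_le_exp abs_mult mult_left_le)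
      qed
      have "(LINT p:Omega|lebesgue. g p * wk K p)
          = (LINT p:Omega|lebesgue. (\<Sum>k<K. mikusinski_coeff (real N * t) k * (g p * cosh (real (Suc k) * real N * fst p))))"
        unfolding wk_def sum_distrib_left by (simp only: mult.left_commute)
      also have "\<dots> = (\<Sum>k<K. mikusinski_coeff (real N * t) k * (LINT p:Omega|lebesgue. g p * cosh (real (Suc k) * real N * fst p)))"
        by (subst set_integral_sum) (simp_all only: set_integral_mult_right set_integrable_mult_right intg)
      also have "\<bar>\<dots>\<bar> \<le> (\<Sum>k<K. exp (- real N) ^ Suc k / fact (Suc k))"
      proof (rule order_trans[OF sum_abs sum_mono])
        fix k
        have "real (Suc k) * real N \<ge> a0" using N by (simp add: algebra_simps add_increasing2)
        from a0[OF this] have 1: "\<bar>LINT p:Omega|lebesgue. g p * cosh (real (Suc k) * real N * fst p)\<bar> \<le> exp (- real N) ^ Suc k"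
          by (simp only: exp_of_nat_mult[symmetric] mult_minus_right)
        have 2: "\<bar>mikusinski_coeff (real N * t) k\<bar> \<le> 1 / fact (Suc k)"
          using t by (intro mikusinski_coeff_bound) auto
        have "\<bar>mikusinski_coeff (real N * t) k\<bar> * \<bar>LINT p:Omega|lebesgue. g p * cosh (real (Suc k) * real N * fst p)\<bar>
            \<le> 1 / fact (Suc k) * exp (- real N) ^ Suc k"
          by (intro mult_mono 1 2) auto
        then show "\<bar>mikusinski_coeff (real N * t) k * (LINT p:Omega|lebesgue. g p * cosh (real (Suc k) * real N * fst p))\<bar>
            \<le> exp (- real N) ^ Suc k / fact (Suc k)"
          by (simp add: abs_mult del: fact_Suc of_nat_Suc power_Suc)
      qed
      also have "\<dots> \<le> exp (exp (- real N)) - 1" by (rule sum_exp_tail_le) simp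
      finally show ?thesis .
    qed
    then show ?thesis
      by (intro tendsto_upperbound[OF tendsto_rabs[OF lim]]) auto
  qed
  have "(\<lambda>N. exp (exp (- real N)) - 1) \<longlonglongrightarrow> exp 0 - 1"
    by (intro tendsto_intros filterlim_compose[OF exp_at_bot]) (simp add: filterlim_uminus_at_top[symmetric] filterlim_real_sequentially)
  then have "(\<lambda>N. exp (exp (- real N)) - 1) \<longlonglongrightarrow> 0" by simp
  moreover have "\<forall>\<^sub>F N in sequentially. norm (LINT p:Omega|lebesgue. g p * mikusinski_kernel (real N) t (fst p)) \<le> exp (exp (- real N)) - 1"
    using eventually_ge_at_top[of "nat \<lceil>a0\<rceil>"] by eventually_elim (auto intro!: kernel_bound)
  ultimately have 0: "(\<lambda>N. LINT p:Omega|lebesgue. g p * mikusinski_kernel (real N) t (fst p)) \<longlonglongrightarrow> 0"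
    by (rule Lim_null_comparison[rotated])
  \<comment> \<open>The closed form of the kernel is bounded by 1 uniformly in \<open>N\<close>,
    whereas the majorant \<open>exp (exp N) - 1\<close> of its partial sums blows up. This is why
    the two limits are taken one after the other.\<close>
  have "(\<lambda>N. LINT p:Omega|lebesgue. g p * mikusinski_kernel (real N) t (fst p)) \<longlonglongrightarrow> (LINT p:Omega|lebesgue. g p * (indicator {t<..} (fst p) / 2))"
  proof (rule set_integral_mult_tendsto[OF g Omega_sets])
    show "(\<lambda>p. mikusinski_kernel (real N) t (fst p)) \<in> borel_measurable lebesgue" for N
      unfolding mikusinski_kernel_def
      by (intro borel_measurable_lebesgueI borel_measurable_continuous_onI continuous_intros) auto
    show "(\<lambda>p::real\<times>real. indicator {t<..} (fst p) / 2 :: real) \<in> borel_measurable lebesgue"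
      by (rule borel_measurable_lebesgueI) (unfold borel_prod[symmetric], measurable)
    show "\<bar>mikusinski_kernel (real N) t (fst p)\<bar> \<le> 1" for N p
    proof -
      have "0 < exp (- exp z) \<and> exp (- exp z) \<le> 1" for z :: real by simp
      moreover have "\<bar>(2 - x - y) / 2\<bar> \<le> 1" if "0 < x \<and> x \<le> 1" "0 < y \<and> y \<le> 1" for x y :: real
        using that by (auto simp: abs_le_iff)
      ultimately show ?thesis unfolding mikusinski_kernel_def by blast
    qed
    show "AE p in lebesgue. p \<in> Omega \<longrightarrow> (\<lambda>N. mikusinski_kernel (real N) t (fst p)) \<longlonglongrightarrow> indicator {t<..} (fst p) / 2"
      using AE_lebesgue_fst_neq[of t]
    proof eventually_elim
      case (elim p)
      show ?case using mikusinski_kernel_tendsto[of "fst p" t] in01[of p] t elim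
        by (auto simp: indicator_def)
    qed
  qed
  from LIMSEQ_unique[OF this 0] show ?thesis by simp
qed


section \<open>Cosine moments in y\<close>

text \<open>The extra factor \<open>cos (n \<pi> y)\<close> lets the product-to-sum formula drive the induction on \<open>k\<close>.\<close>
lemma cos_moments_imp_power_moments:
  fixes h :: "real \<times> real \<Rightarrow> real"
  assumes h: "set_integrable lebesgue Omega h"
    and zero: "\<And>n::nat. (LINT p:Omega|lebesgue. h p * cos (real n * pi * snd p)) = 0"
  shows "(LINT p:Omega|lebesgue. h p * (cos (pi * snd p) ^ k * cos (real n * pi * snd p))) = 0"
proof (induction k arbitrary: n)
  case 0
  show ?case using zero by simp
next
  case (Suc k)
  have int: "set_integrable lebesgue Omega (\<lambda>p. h p * (cos (pi * snd p) ^ k * cos (real n * pi * snd p)))" for n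
  proof (rule set_integrable_mult_bounded[OF h Omega_sets])
    show "(\<lambda>p::real\<times>real. cos (pi * snd p) ^ k * cos (real n * pi * snd p)) \<in> borel_measurable lebesgue"
      by (intro borel_measurable_lebesgueI borel_measurable_continuous_onI continuous_intros)
    show "\<bar>cos (pi * snd p) ^ k * cos (real n * pi * snd p)\<bar> \<le> 1" for p :: "real\<times>real"
      by (simp add: abs_mult power_abs mult_le_one power_le_one)
  qed
  show ?case
  proof (cases n)
    case 0
    \<comment> \<open>For \<open>n = 0\<close> the extra cosine is 1, and one of the factors
      \<open>cos (pi y)\<close> takes its place as the cosine of index 1.\<close>
    then show ?thesis using Suc.IH[of 1] by (simp add: mult.commute)
  next
    case (Suc m)
    have "cos (pi * y) * cos (real n * pi * y) = (cos (real (Suc n) * pi * y) + cos (real m * pi * y)) / 2" for y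
    proof -
      have "real (Suc n) * pi * y = real n * pi * y + pi * y" "real m * pi * y = real n * pi * y - pi * y"
        using Suc by (simp_all add: algebra_simps)
      then show ?thesis by (simp add: cos_add cos_diff)
    qed
    then have "h p * (cos (pi * snd p) ^ Suc k * cos (real n * pi * snd p)) =
       h p * cos (pi * snd p) ^ k * ((cos (real (Suc n) * pi * snd p) + cos (real m * pi * snd p)) / 2)" for p
      by (metis (no_types) power_Suc2 mult.assoc)
    also have "h p * cos (pi * snd p) ^ k * ((cos (real (Suc n) * pi * snd p) + cos (real m * pi * snd p)) / 2) = (h p * (cos (pi * snd p) ^ k * cos (real (Suc n) * pi * snd p)) + h p * (cos (pi * snd p) ^ k * cos (real m * pi * snd p))) / 2" for p
      by (simp add: algebra_simps del: of_nat_Suc)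
    finally have eq: "h p * (cos (pi * snd p) ^ Suc k * cos (real n * pi * snd p)) =
       (h p * (cos (pi * snd p) ^ k * cos (real (Suc n) * pi * snd p)) + h p * (cos (pi * snd p) ^ k * cos (real m * pi * snd p))) / 2" for p
      .
    show ?thesis
      unfolding eq using Suc.IH[of "Suc n"] Suc.IH[of m] int[of "Suc n"] int[of m] by (simp del: of_nat_Suc power_Suc)
  qed
qed

text \<open>Since \<open>cos (pi y)\<close> decreases strictly on \<open>[0,1]\<close>, the
  condition \<open>y > s\<close> is one on the value \<open>z = cos (pi y)\<close>, namely
  \<open>z < cos (pi s)\<close>. Its indicator is a limit of continuous functions of
  \<open>z\<close>, which Weierstrass replaces by polynomials, and these integrate to zero against
  \<open>h\<close>.\<close>

lemma cos_moments_zero_imp_zero: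
  fixes h :: "real \<times> real \<Rightarrow> real"
  assumes h: "set_integrable lebesgue Omega h"
    and zero: "\<And>n::nat. (LINT p:Omega|lebesgue. h p * cos (real n * pi * snd p)) = 0"
    and s: "0 \<le> s" "s \<le> 1"
  shows "(LINT p:Omega|lebesgue. h p * indicator {s<..} (snd p)) = 0"
proof -
  \<comment> \<open>Ramps of slope \<open>k\<close>, cut off at height 1, that increase to the
    indicator of \<open>z < cos (pi s)\<close>.\<close>
  define q where "q = (\<lambda>k z. min 1 (real k * max 0 (cos (pi * s) - z)))"
  have poly_approx: "\<exists>P. real_polynomial_function P \<and> (\<forall>z\<in>{-1..1}. \<bar>q k z - P z\<bar> < 1 / real (Suc k))" for k
  proof -
    have "continuous_on {-1..1} (q k)" unfolding q_def by (intro continuous_intros)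
    from Stone_Weierstrass_real_polynomial_function[OF compact_Icc this, of "1 / real (Suc k)"]
    show ?thesis by (metis of_nat_0_less_iff zero_less_Suc zero_less_divide_1_iff)
  qed
  then obtain P where P: "\<And>k. real_polynomial_function (P k)"
    and approx: "\<And>k z. z \<in> {-1..1} \<Longrightarrow> \<bar>q k z - P k z\<bar> < 1 / real (Suc k)"
    by metis
  have cos_meas: "(\<lambda>p::real\<times>real. cos (pi * snd p) ^ i) \<in> borel_measurable lebesgue" for i
    by (intro borel_measurable_lebesgueI borel_measurable_continuous_onI continuous_intros)
  have int0: "(LINT p:Omega|lebesgue. h p * P k (cos (pi * snd p))) = 0" for k
  proof -
    obtain a n where Pk: "P k = (\<lambda>x. \<Sum>i\<le>n. a i * x ^ i)"
      using P[of k] unfolding real_polynomial_function_iff_sum by blast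
    have i: "set_integrable lebesgue Omega (\<lambda>p. h p * cos (pi * snd p) ^ i)" for i
      by (rule set_integrable_mult_bounded[OF h Omega_sets cos_meas, of _ 1]) (simp add: power_abs power_le_one)
    have "(LINT p:Omega|lebesgue. h p * P k (cos (pi * snd p))) = (LINT p:Omega|lebesgue. (\<Sum>i\<le>n. a i * (h p * cos (pi * snd p) ^ i)))"
      unfolding Pk by (simp add: sum_distrib_left mult.left_commute)
    also have "\<dots> = (\<Sum>i\<le>n. a i * (LINT p:Omega|lebesgue. h p * cos (pi * snd p) ^ i))"
      by (subst set_integral_sum) (simp_all only: set_integral_mult_right set_integrable_mult_right i)
    also have "\<dots> = 0"
      using cos_moments_imp_power_moments[OF h zero, of _ 0] by simp
    finally show ?thesis .
  qed
  have "(\<lambda>k. LINT p:Omega|lebesgue. h p * P k (cos (pi * snd p))) \<longlonglongrightarrow> (LINT p:Omega|lebesgue. h p * indicator {s<..} (snd p))"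
  proof (rule set_integral_mult_tendsto[OF h Omega_sets])
    show "(\<lambda>p::real\<times>real. P k (cos (pi * snd p))) \<in> borel_measurable lebesgue" for k
    proof -
      have "continuous_on UNIV (P k)"
        using P[of k] by (simp add: continuous_on_polymonial_function real_polynomial_function_eq)
      then have "continuous_on UNIV (\<lambda>p::real\<times>real. P k (cos (pi * snd p)))"
        by (rule continuous_on_compose2) (intro continuous_intros subset_UNIV)+
      then show ?thesis
        by (intro borel_measurable_lebesgueI borel_measurable_continuous_onI)
    qed
    show "(\<lambda>p::real\<times>real. indicator {s<..} (snd p) :: real) \<in> borel_measurable lebesgue"
      by (rule borel_measurable_lebesgueI) (unfold borel_prod[symmetric], measurable)
    \<comment> \<open>The ramp contributes at most 1, and so does the approximation error
      \<open>1 / (k + 1)\<close>.\<close>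
    show "\<bar>P k (cos (pi * snd p))\<bar> \<le> 2" for k p
    proof -
      have "\<bar>q k (cos (pi * snd p))\<bar> \<le> 1" proof -
        have "0 \<le> real k * max 0 (cos (pi * s) - cos (pi * snd p))" by simp
        then show ?thesis unfolding q_def by linarith
      qed
      moreover have "1 / real (Suc k) \<le> 1" by simp
      moreover have "\<bar>q k (cos (pi * snd p)) - P k (cos (pi * snd p))\<bar> < 1 / real (Suc k)"
        by (rule approx) simp
      ultimately show ?thesis by linarith
    qed
    have "(\<lambda>k. P k (cos (pi * snd p))) \<longlonglongrightarrow> indicator {s<..} (snd p)" if "p \<in> Omega" for p
    proof -
      have y: "0 < snd p" "snd p < 1" using that by (auto simp: Omega_def)
      have "(\<lambda>k. q k (cos (pi * snd p)) - P k (cos (pi * snd p))) \<longlonglongrightarrow> 0"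
      proof (rule Lim_null_comparison)
        show "\<forall>\<^sub>F k in sequentially. norm (q k (cos (pi * snd p)) - P k (cos (pi * snd p))) \<le> 1 / real (Suc k)"
          using approx[of "cos (pi * snd p)"] by (intro always_eventually allI) (simp add: less_imp_le)
        show "(\<lambda>k. 1 / real (Suc k)) \<longlonglongrightarrow> 0"
          using LIMSEQ_inverse_real_of_nat by (simp add: inverse_eq_divide)
      qed
      moreover have "(\<lambda>k. q k (cos (pi * snd p))) \<longlonglongrightarrow> indicator {s<..} (snd p)"
      proof (cases "s < snd p")
        case True
        then have d: "0 < cos (pi * s) - cos (pi * snd p)"
          using s y by (simp add: cos_mono_less_eq)
        have "\<forall>\<^sub>F k in sequentially. 1 / (cos (pi * s) - cos (pi * snd p)) \<le> real k"
          using filterlim_real_sequentially by (simp add: filterlim_at_top)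
        then have "\<forall>\<^sub>F k in sequentially. q k (cos (pi * snd p)) = 1"
        proof eventually_elim
          case (elim k)
          then show ?case using d unfolding q_def by (simp add: field_simps max_def min_def)
        qed
        then have "(\<lambda>k. q k (cos (pi * snd p))) \<longlonglongrightarrow> 1" by (rule tendsto_eventually)
        with True show ?thesis by simp
      next
        case False
        then have "cos (pi * s) - cos (pi * snd p) \<le> 0"
          using s y by (simp add: cos_mono_le_eq)
        then have "q k (cos (pi * snd p)) = 0" for k unfolding q_def by simp
        with False show ?thesis by simp
      qed
      ultimately have "(\<lambda>k. q k (cos (pi * snd p)) - (q k (cos (pi * snd p)) - P k (cos (pi * snd p)))) \<longlonglongrightarrow> indicator {s<..} (snd p) - 0"
        by (intro tendsto_diff)
      then show ?thesis by simp
    qed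
    then show "AE p in lebesgue. p \<in> Omega \<longrightarrow> (\<lambda>k. P k (cos (pi * snd p))) \<longlonglongrightarrow> indicator {s<..} (snd p)"
      by simp
  qed
  then show ?thesis
    unfolding int0 using LIMSEQ_unique[OF tendsto_const] by metis
qed

section \<open>From quadrants to vanishing almost everywhere\<close>

text \<open>Quadrants are stable under intersection and generate the Borel sets, so by Dynkin's
  lemma the integral over every Borel set vanishes.\<close>

lemma integral_zero_on_quadrants_imp_AE_zero:
  fixes F :: "real \<times> real \<Rightarrow> real"
  assumes F: "integrable lebesgue F"
    and zero: "\<And>a b. (LINT p:{a<..} \<times> {b<..}|lebesgue. F p) = 0"
  shows "AE p in lebesgue. F p = 0"
proof -
  have Fm: "F \<in> borel_measurable lebesgue" using F by simp
  \<comment> \<open>Quadrants generate the Borel sets only, not the Lebesgue sets, so the argument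
    runs on a Borel version of \<open>F\<close>.\<close>
  obtain G where [measurable]: "G \<in> borel_measurable lborel" and GF: "AE p in lborel. F p = G p"
    using completion_ex_borel_measurable_real[OF Fm] by blast
  have GF': "AE p in lebesgue. F p = G p" using GF by (rule AE_completion)
  have Gl: "G \<in> borel_measurable lebesgue" by (simp add: measurable_completion)
  have G: "integrable lborel G"
    using F integrable_cong_AE[OF Fm Gl GF'] by (simp add: integrable_completion)
  have eq: "(LINT p:A|lborel. G p) = (LINT p:A|lebesgue. F p)" if "A \<in> sets borel" for A
  proof -
    have [measurable]: "A \<in> sets lborel" using that by simp
    have "(LINT p:A|lborel. G p) = (LINT p:A|lebesgue. G p)"
      unfolding set_lebesgue_integral_def by (rule integral_completion[symmetric]) measurable
    also have "\<dots> = (LINT p:A|lebesgue. F p)"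
      using GF' that by (intro set_lebesgue_integral_cong_AE) (auto intro: Fm Gl)
    finally show ?thesis .
  qed
  have Gs: "set_integrable lborel A G" if "A \<in> sets borel" for A
    unfolding set_integrable_def using G that by (intro integrable_mult_indicator) auto
  have all0: "(LINT p:A|lborel. G p) = 0" if "A \<in> sets borel" for A
  proof -
    let ?E = "range (\<lambda>a::real\<times>real. {x. eucl_less a x})"
    have Ea: "{x. eucl_less a x} = {fst a<..} \<times> {snd a<..}" for a :: "real \<times> real"
      by (auto simp: eucl_less_def Basis_prod_def inner_prod_def)
    have "Int_stable ?E"
    proof (rule Int_stableI)
      fix A B assume "A \<in> ?E" "B \<in> ?E"
      then obtain a b :: "real \<times> real" where "A = {x. eucl_less a x}" "B = {x. eucl_less b x}" by auto
      then have "A \<inter> B = {x. eucl_less (max (fst a) (fst b), max (snd a) (snd b)) x}"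
        unfolding Ea by auto
      then show "A \<inter> B \<in> ?E" by blast
    qed
    moreover have "?E \<subseteq> Pow UNIV" by simp
    moreover have "A \<in> sigma_sets UNIV ?E"
      using that unfolding borel_eq_greaterThan by simp
    ultimately show ?thesis
    proof (induction rule: sigma_sets_induct_disjoint)
      case (basic A)
      then obtain a :: "real \<times> real" where A: "A = {fst a<..} \<times> {snd a<..}" using Ea by auto
      have "open A" unfolding A by (intro open_Times open_greaterThan)
      then show ?case using eq[of A] zero[of "fst a" "snd a"] A by simp
    next
      case empty
      show ?case by (simp add: set_lebesgue_integral_def)
    next
      case (compl A)
      then have A: "A \<in> sets borel" unfolding borel_eq_greaterThan by simp
      \<comment> \<open>Complements need the integral over the whole plane. It is not itself an
        integral over a quadrant, but the plane is an increasing union of quadrants.\<close>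
      have "(LINT p|lborel. G p) = 0"
      proof -
        have "(\<lambda>n. LINT p:({- real n<..} \<times> {- real n<..})|lborel. G p) \<longlonglongrightarrow> (LINT p:(\<Union>n. {- real n<..} \<times> {- real n<..})|lborel. G p)"
        proof (rule set_integral_cont_up)
          have o: "open ({- real n<..} \<times> {- real n<..})" for n by (intro open_Times open_greaterThan)
          show "{- real n<..} \<times> {- real n<..} \<in> sets lborel" for n using o by simp
          show "incseq (\<lambda>n. {- real n<..} \<times> {- real n<..})" by (auto simp: incseq_def)
          show "set_integrable lborel (\<Union>n. {- real n<..} \<times> {- real n<..}) G"
            using o by (intro Gs) auto
        qed
        moreover have "(\<Union>n. {- real n<..} \<times> {- real n<..}) = UNIV"
        proof -
          have "\<exists>n. - real n < x \<and> - real n < y" for x y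
          proof -
            obtain n where "real n > max (-x) (-y)" using reals_Archimedean2 by blast
            then show ?thesis by (intro exI[of _ n]) auto
          qed
          then show ?thesis by auto
        qed
        moreover have "(LINT p:({- real n<..} \<times> {- real n<..})|lborel. G p) = 0" for n
        proof -
          have "open ({- real n<..} \<times> {- real n<..})" by (intro open_Times open_greaterThan)
          then show ?thesis using eq zero by simp
        qed
        ultimately have "(\<lambda>n::nat. 0) \<longlonglongrightarrow> (LINT p:UNIV|lborel. G p)" by simp
        from LIMSEQ_unique[OF tendsto_const this] show ?thesis
          by (simp add: set_lebesgue_integral_def)
      qed
      moreover have "(LINT p:(UNIV - A)|lborel. G p) + (LINT p:A|lborel. G p) = (LINT p:((UNIV - A) \<union> A)|lborel. G p)"
        using A G by (intro set_integral_Un[symmetric]) (auto intro!: Gs)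
      ultimately show ?case using compl by (simp add: set_lebesgue_integral_def)
    next
      case (union A)
      have "(LINT p:(\<Union>i. A i)|lborel. G p) = (\<Sum>i. LINT p:(A i)|lborel. G p)"
      proof (rule lebesgue_integral_countable_add)
        have s: "A i \<in> sets borel" for i using union unfolding borel_eq_greaterThan by auto
        then show "A i \<in> sets lborel" for i by simp
        show "A i \<inter> A j = {}" if "i \<noteq> j" for i j using union that by (auto simp: disjoint_family_on_def)
        show "set_integrable lborel (\<Union>i. A i) G"
          using s by (intro Gs) auto
      qed
      then show ?case using union by simp
    qed
  qed
  have "AE p in lborel. G p = 0"
    using sigma_finite_measure.density_zero[OF _ G] lborel.sigma_finite_measure_axioms all0 by simp
  then have "AE p in lborel. F p = 0" using GF by eventually_elim simp
  then show ?thesis by (rule AE_completion)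
qed

text \<open>The variable \<open>x\<close> is treated first, with \<open>n\<close> fixed, because
  only the \<open>cosh\<close> moments come with a rate; what remains is a family of cosine moments
  in \<open>y\<close> that vanish exactly.\<close>

lemma cosh_cos_moments_small_imp_AE_zero:
  fixes f :: "real \<times> real \<Rightarrow> real"
  assumes f: "set_integrable lebesgue Omega f"
    and small: "\<And>n::nat. \<forall>\<^sub>F a in at_top.
       \<bar>LINT p:Omega|lebesgue. f p * (cosh (a * fst p) * cos (real n * pi * snd p))\<bar> \<le> exp (- a)"
  shows "AE p in lebesgue. p \<in> Omega \<longrightarrow> f p = 0"
proof -
  have ind: "(\<lambda>p::real\<times>real. indicator {t<..} (fst p) :: real) \<in> borel_measurable lebesgue" for t
    by (rule borel_measurable_lebesgueI) (unfold borel_prod[symmetric], measurable)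
  have quad: "(LINT p:Omega|lebesgue. f p * indicator {t<..} (fst p) * indicator {s<..} (snd p)) = 0"
    if t: "0 \<le> t" and s: "0 \<le> s" "s \<le> 1" for s t
  proof (rule cos_moments_zero_imp_zero)
    show "set_integrable lebesgue Omega (\<lambda>p. f p * indicator {t<..} (fst p))"
      by (rule set_integrable_mult_bounded[OF f Omega_sets ind, of _ 1]) (auto simp: indicator_def)
    show "(LINT p:Omega|lebesgue. f p * indicator {t<..} (fst p) * cos (real n * pi * snd p)) = 0" for n :: nat
    proof -
      have "(LINT p:Omega|lebesgue. (f p * cos (real n * pi * snd p)) * indicator {t<..} (fst p)) = 0"
      proof (rule cosh_moments_small_imp_zero[OF _ _ t])
        show "set_integrable lebesgue Omega (\<lambda>p. f p * cos (real n * pi * snd p))"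
          by (rule set_integrable_mult_bounded[OF f Omega_sets, of _ 1])
            (auto intro!: borel_measurable_lebesgueI borel_measurable_continuous_onI continuous_intros)
        show "\<forall>\<^sub>F a in at_top. \<bar>LINT p:Omega|lebesgue. f p * cos (real n * pi * snd p) * cosh (a * fst p)\<bar> \<le> exp (- a)"
          using small[of n] by (simp add: mult_ac)
      qed
      then show ?thesis by (simp add: mult_ac)
    qed
  qed (use s in auto)
  have "AE p in lebesgue. indicat_real Omega p * f p = 0"
  proof (rule integral_zero_on_quadrants_imp_AE_zero)
    show "integrable lebesgue (\<lambda>p. indicat_real Omega p * f p)"
      using f by (simp add: set_integrable_def)
    show "(LINT p:{a<..} \<times> {b<..}|lebesgue. indicat_real Omega p * f p) = 0" for a b
    proof -
      \<comment> \<open>The corner is clipped to \<open>a \<ge> 0\<close> and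
        \<open>0 \<le> b \<le> 1\<close>, the range covered by \<open>quad\<close>; inside the open
        unit square this changes nothing.\<close>
      have "(LINT p:{a<..} \<times> {b<..}|lebesgue. indicat_real Omega p * f p) =
        (LINT p:Omega|lebesgue. f p * indicator {max a 0<..} (fst p) * indicator {min 1 (max b 0)<..} (snd p))"
        unfolding set_lebesgue_integral_def
        by (intro Bochner_Integration.integral_cong) (auto simp: indicator_def Omega_def)
      also have "\<dots> = 0" by (rule quad) auto
      finally show ?thesis .
    qed
  qed
  then show ?thesis by eventually_elim auto
qed

section \<open>Integration by parts with vanishing traces\<close>

text \<open>\<open>smooth_step\<close> below is the integral of the hat function on \<open>[1, 3]\<close>.\<close>
definition ramp :: "real \<Rightarrow> real" where
  "ramp r = (max 0 r)\<^sup>2 / 2"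

text \<open>\<open>test_fun\<close> asks for continuous first derivatives only, so spliced parabolas
  are smooth enough. At the junction the difference quotient is bounded by its increment.\<close>

lemma ramp_deriv: "(ramp has_real_derivative max 0 r) (at r)"
proof -
  consider "r > 0" | "r < 0" | "r = 0" by linarith
  then show ?thesis
  proof cases
    case 1
    have "((\<lambda>r. r\<^sup>2 / 2) has_real_derivative max 0 r) (at r)"
      using 1 by (auto intro!: derivative_eq_intros)
    then show ?thesis
      by (rule has_field_derivative_transform_within_open[of _ _ _ "{0<..}"]) (use 1 in \<open>auto simp: ramp_def\<close>)
  next
    case 2
    have "((\<lambda>r. 0) has_real_derivative max 0 r) (at r)"
      using 2 by (auto intro!: derivative_eq_intros)
    then show ?thesis
      by (rule has_field_derivative_transform_within_open[of _ _ _ "{..<0}"]) (use 2 in \<open>auto simp: ramp_def\<close>)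
  next
    case 3
    have "(\<lambda>y. (ramp (0 + y) - ramp 0) / y) \<midarrow>0\<rightarrow> 0"
    proof (rule Lim_null_comparison)
      show "\<forall>\<^sub>F y in at 0. norm ((ramp (0 + y) - ramp 0) / y) \<le> \<bar>y\<bar>"
        by (intro always_eventually allI) (auto simp: ramp_def max_def power2_eq_square)
      show "((\<lambda>y. \<bar>y\<bar>) \<longlongrightarrow> 0) (at (0::real))"
        using tendsto_rabs_zero[OF tendsto_ident_at] .
    qed
    with 3 show ?thesis by (simp add: DERIV_def)
  qed
qed

definition smooth_step :: "real \<Rightarrow> real" where
  "smooth_step r = ramp (r - 1) - 2 * ramp (r - 2) + ramp (r - 3)"

definition smooth_step' :: "real \<Rightarrow> real" where
  "smooth_step' r = max 0 (r - 1) - 2 * max 0 (r - 2) + max 0 (r - 3)"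

lemma smooth_step_deriv: "(smooth_step has_real_derivative smooth_step' r) (at r)"
proof -
  have sh: "((\<lambda>r. ramp (r - c)) has_real_derivative max 0 (r - c)) (at r)" for c
    by (rule DERIV_cong[OF DERIV_chain2[where f=ramp and g="\<lambda>r. r - c", OF ramp_deriv]])
      (auto intro!: derivative_eq_intros)
  show ?thesis
    unfolding smooth_step_def[abs_def] smooth_step'_def
    by (intro DERIV_add DERIV_diff DERIV_cmult sh)
qed

lemma smooth_step_low: "r \<le> 1 \<Longrightarrow> smooth_step r = 0"
  by (simp add: smooth_step_def ramp_def)

lemma smooth_step_high: "r \<ge> 3 \<Longrightarrow> smooth_step r = 1"
  by (simp add: smooth_step_def ramp_def power2_eq_square algebra_simps add_divide_distrib diff_divide_distrib)

lemma smooth_step'_high: "r \<ge> 3 \<Longrightarrow> smooth_step' r = 0"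
  by (simp add: smooth_step'_def)

lemma smooth_step'_bound: "\<bar>smooth_step' r\<bar> \<le> 1"
  by (auto simp: smooth_step'_def max_def abs_if)

lemma smooth_step_range: "0 \<le> smooth_step r" "smooth_step r \<le> 1"
proof -
  have mid: "smooth_step r = 1 - (3 - r)\<^sup>2 / 2" if "2 \<le> r" "r \<le> 3"
    using that by (simp add: smooth_step_def ramp_def power2_eq_square algebra_simps add_divide_distrib diff_divide_distrib)
  have low: "smooth_step r = (r - 1)\<^sup>2 / 2" if "1 \<le> r" "r \<le> 2"
    using that by (simp add: smooth_step_def ramp_def)
  have sq: "0 \<le> z\<^sup>2 \<and> z\<^sup>2 \<le> 1" if "0 \<le> z" "z \<le> 1" for z :: real
    using that by (simp add: power_le_one)
  consider "r \<le> 1" | "1 \<le> r" "r \<le> 2" | "2 \<le> r" "r \<le> 3" | "r \<ge> 3" by linarith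
  then have "0 \<le> smooth_step r \<and> smooth_step r \<le> 1"
  proof cases
    case 1 then show ?thesis by (simp add: smooth_step_low)
  next
    case 2 then show ?thesis using sq[of "r - 1"] unfolding low[OF 2] by simp
  next
    case 3 then show ?thesis using sq[of "3 - r"] unfolding mid[OF 3] by simp
  next
    case 4 then show ?thesis by (simp add: smooth_step_high)
  qed
  then show "0 \<le> smooth_step r" "smooth_step r \<le> 1" by auto
qed

section \<open>Cutoffs of the unit interval\<close>

text \<open>The scaling \<open>3 / s\<close> moves the transition interval \<open>[1,3]\<close> of
  \<open>smooth_step\<close> to distances between \<open>s / 3\<close> and \<open>s\<close> from
  each end: the support stays away from the boundary, while the derivative lives on strips of width
  \<open>s\<close>.\<close>

definition cutoff :: "real \<Rightarrow> real \<Rightarrow> real" where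
  "cutoff s x = smooth_step (3 * x / s) * smooth_step (3 * (1 - x) / s)"

definition cutoff' :: "real \<Rightarrow> real \<Rightarrow> real" where
  "cutoff' s x = 3 / s * (smooth_step' (3 * x / s) * smooth_step (3 * (1 - x) / s)
     - smooth_step (3 * x / s) * smooth_step' (3 * (1 - x) / s))"

lemma cutoff_deriv: "(cutoff s has_real_derivative cutoff' s x) (at x)"
proof -
  have 1: "((\<lambda>x. smooth_step (3 * x / s)) has_real_derivative smooth_step' (3 * x / s) * (3 / s)) (at x)"
    by (rule DERIV_chain2[OF smooth_step_deriv]) (rule DERIV_cdivide, auto intro!: derivative_eq_intros)
  have 2: "((\<lambda>x. smooth_step (3 * (1 - x) / s)) has_real_derivative smooth_step' (3 * (1 - x) / s) * (- 3 / s)) (at x)"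
    by (rule DERIV_chain2[OF smooth_step_deriv]) (rule DERIV_cdivide, auto intro!: derivative_eq_intros)
  show ?thesis
    unfolding cutoff_def[abs_def]
    by (rule DERIV_cong[OF DERIV_mult[OF 1 2]]) (simp add: cutoff'_def algebra_simps)
qed

lemma continuous_on_smooth_step: "continuous_on S smooth_step"
  using smooth_step_deriv by (meson DERIV_isCont continuous_at_imp_continuous_on)

lemma continuous_on_cutoff': "continuous_on S (cutoff' s)"
proof -
  have "continuous_on UNIV smooth_step'"
    unfolding smooth_step'_def by (intro continuous_intros)
  then have c: "continuous_on S (\<lambda>x. smooth_step' (3 * x / s))" "continuous_on S (\<lambda>x. smooth_step' (3 * (1 - x) / s))"
    unfolding divide_inverse
    by (rule continuous_on_compose2; intro continuous_intros subset_UNIV)+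
  have d: "continuous_on S (\<lambda>x. smooth_step (3 * x / s))" "continuous_on S (\<lambda>x. smooth_step (3 * (1 - x) / s))"
    unfolding divide_inverse
    by (rule continuous_on_compose2[OF continuous_on_smooth_step[of UNIV]]; intro continuous_intros subset_UNIV)+
  show ?thesis
    unfolding cutoff'_def[abs_def] by (intro continuous_intros c d)
qed

lemma cutoff_range: "0 \<le> cutoff s x" "cutoff s x \<le> 1"
  using smooth_step_range unfolding cutoff_def by (auto intro: mult_le_one)

lemma cutoff_nonzero:
  assumes "s > 0" "cutoff s x \<noteq> 0" shows "x \<in> {s / 3..1 - s / 3}"
proof -
  have "3 * x / s > 1" "3 * (1 - x) / s > 1"
    using assms smooth_step_low unfolding cutoff_def by (metis linorder_not_less mult_zero_left mult_zero_right)+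
  then show ?thesis using assms by (auto simp: field_simps)
qed

text \<open>The factor \<open>3 / s\<close> comes from the chain rule. Its order
  \<open>1 / s\<close> matches the normalization of the strip averages that define zero traces, so
  boundary terms are at most three times such averages.\<close>

lemma cutoff'_bound:
  assumes "s > 0" shows "\<bar>cutoff' s x\<bar> \<le> 3 / s * (indicator {..<s} x + indicator {1 - s<..} x)"
proof -
  have 1: "\<bar>smooth_step' (3 * x / s) * smooth_step (3 * (1 - x) / s)\<bar> \<le> indicator {..<s} x"
    using smooth_step'_high[of "3 * x / s"] smooth_step'_bound[of "3 * x / s"] smooth_step_range[of "3 * (1 - x) / s"] assms
    by (cases "x < s") (auto simp: abs_mult pos_le_divide_eq intro: mult_le_one)
  have 2: "\<bar>smooth_step (3 * x / s) * smooth_step' (3 * (1 - x) / s)\<bar> \<le> indicator {1 - s<..} x"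
    using smooth_step'_high[of "3 * (1 - x) / s"] smooth_step'_bound[of "3 * (1 - x) / s"] smooth_step_range[of "3 * x / s"] assms
    by (cases "1 - s < x") (auto simp: abs_mult pos_le_divide_eq intro: mult_le_one)
  have "\<bar>cutoff' s x\<bar> = 3 / s * \<bar>smooth_step' (3 * x / s) * smooth_step (3 * (1 - x) / s)
     - smooth_step (3 * x / s) * smooth_step' (3 * (1 - x) / s)\<bar>"
    unfolding cutoff'_def abs_mult using assms by simp
  also have "\<dots> \<le> 3 / s * (indicator {..<s} x + indicator {1 - s<..} x)"
    using 1 2 assms by (intro mult_left_mono) auto
  finally show ?thesis .
qed

lemma cutoff_tendsto:
  assumes "0 < x" "x < 1" shows "((\<lambda>s. cutoff s x) \<longlongrightarrow> 1) (at_right 0)"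
proof (rule tendsto_eventually)
  have "\<forall>\<^sub>F s in at_right 0. 0 < s \<and> s < min x (1 - x)"
    using assms by (intro eventually_conj eventually_at_right_less order_tendstoD(2)[OF tendsto_ident_at]) auto
  then show "\<forall>\<^sub>F s in at_right 0. cutoff s x = 1"
  proof eventually_elim
    case (elim s)
    then have "3 * x / s \<ge> 3" "3 * (1 - x) / s \<ge> 3" by (auto simp: field_simps)
    then show ?case by (simp add: cutoff_def smooth_step_high)
  qed
qed

text \<open>The regularity half of \<open>test_fun\<close>. The weights do not vanish near the
  boundary and become test functions only after multiplication by cutoffs.\<close>

definition C1_fun :: "((real \<times> real) \<Rightarrow> real) \<Rightarrow> ((real \<times> real) \<Rightarrow> real) \<Rightarrow> ((real \<times> real) \<Rightarrow> real) \<Rightarrow> bool" where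
  "C1_fun psi psix psiy \<longleftrightarrow>
     (\<forall>p. (psi has_derivative (\<lambda>h. fst h * psix p + snd h * psiy p)) (at p)) \<and>
     continuous_on UNIV psix \<and> continuous_on UNIV psiy"

lemma C1_fun_continuous: "C1_fun psi psix psiy \<Longrightarrow> continuous_on UNIV psi"
  unfolding C1_fun_def by (meson continuous_at_imp_continuous_on has_derivative_continuous)

lemma C1_fun_prod:
  assumes F: "\<And>x. (F has_real_derivative F' x) (at x)" and G: "\<And>x. (G has_real_derivative G' x) (at x)"
    and c: "continuous_on UNIV F'" "continuous_on UNIV G'"
  shows "C1_fun (\<lambda>p. F (fst p) * G (snd p)) (\<lambda>p. F' (fst p) * G (snd p)) (\<lambda>p. F (fst p) * G' (snd p))"
proof -
  have FG: "continuous_on UNIV F" "continuous_on UNIV G"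
    using F G by (meson DERIV_isCont continuous_at_imp_continuous_on)+
  have "((\<lambda>p. F (fst p) * G (snd p)) has_derivative (\<lambda>h. fst h * (F' (fst p) * G (snd p)) + snd h * (F (fst p) * G' (snd p)))) (at p)" for p
  proof -
    have 1: "((\<lambda>p. F (fst p)) has_derivative (\<lambda>h. F' (fst p) * fst h)) (at p)"
      using has_derivative_compose[OF has_derivative_fst[OF has_derivative_ident] F[of "fst p", unfolded has_field_derivative_def]] .
    have 2: "((\<lambda>p. G (snd p)) has_derivative (\<lambda>h. G' (snd p) * snd h)) (at p)"
      using has_derivative_compose[OF has_derivative_snd[OF has_derivative_ident] G[of "snd p", unfolded has_field_derivative_def]] .
    show ?thesis
      by (rule has_derivative_eq_rhs[OF has_derivative_mult[OF 1 2]]) (auto simp: algebra_simps)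
  qed
  moreover have "continuous_on UNIV (\<lambda>p::real\<times>real. K (fst p))" "continuous_on UNIV (\<lambda>p::real\<times>real. K (snd p))"
    if "continuous_on UNIV K" for K :: "real \<Rightarrow> real"
    by (rule continuous_on_compose2[OF that]; intro continuous_intros subset_UNIV)+
  ultimately show ?thesis
    unfolding C1_fun_def using c FG by (auto intro!: continuous_on_mult)
qed

lemma C1_fun_mult:
  assumes f: "C1_fun f fx fy" and g: "C1_fun g gx gy"
  shows "C1_fun (\<lambda>p. f p * g p) (\<lambda>p. fx p * g p + f p * gx p) (\<lambda>p. fy p * g p + f p * gy p)"
proof -
  have "((\<lambda>p. f p * g p) has_derivative (\<lambda>h. fst h * (fx p * g p + f p * gx p) + snd h * (fy p * g p + f p * gy p))) (at p)" for p
  proof -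
    have 1: "(f has_derivative (\<lambda>h. fst h * fx p + snd h * fy p)) (at p)"
      and 2: "(g has_derivative (\<lambda>h. fst h * gx p + snd h * gy p)) (at p)"
      using f g unfolding C1_fun_def by blast+
    show ?thesis
      by (rule has_derivative_eq_rhs[OF has_derivative_mult[OF 1 2]]) (auto simp: algebra_simps)
  qed
  then show ?thesis
    using f g C1_fun_continuous[OF f] C1_fun_continuous[OF g]
    unfolding C1_fun_def by (auto intro!: continuous_on_mult continuous_on_add)
qed

lemma test_fun_cutoff:
  assumes psi: "C1_fun psi psix psiy" and s: "s > 0"
  shows "test_fun (\<lambda>p. psi p * (cutoff s (fst p) * cutoff s (snd p)))
     (\<lambda>p. psix p * (cutoff s (fst p) * cutoff s (snd p)) + psi p * (cutoff' s (fst p) * cutoff s (snd p)))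
     (\<lambda>p. psiy p * (cutoff s (fst p) * cutoff s (snd p)) + psi p * (cutoff s (fst p) * cutoff' s (snd p)))"
    (is "test_fun ?f ?fx ?fy")
proof -
  have C1: "C1_fun ?f ?fx ?fy"
    by (intro C1_fun_mult[OF psi] C1_fun_prod cutoff_deriv continuous_on_cutoff')
  let ?K = "{s / 3..1 - s / 3} \<times> {s / 3..1 - s / 3}"
  have K: "compact ?K" by (intro compact_Times compact_Icc)
  have "{p. ?f p \<noteq> 0} \<subseteq> ?K"
    using cutoff_nonzero[OF s] by (force simp: mem_Times_iff)
  then have sub: "closure {p. ?f p \<noteq> 0} \<subseteq> ?K"
    using K by (simp add: closure_minimal compact_imp_closed)
  moreover have "?K \<subseteq> Omega" using s by (auto simp: Omega_def)
  moreover have "compact (closure {p. ?f p \<noteq> 0})"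
    using compact_Int_closed[OF K closed_closure, of "{p. ?f p \<noteq> 0}"] sub by (simp add: Int_absorb1)
  ultimately show ?thesis
    using C1 unfolding test_fun_def C1_fun_def by blast
qed

lemma continuous_bounded_Omega:
  fixes w :: "real \<times> real \<Rightarrow> real"
  assumes "continuous_on UNIV w"
  obtains B where "B > 0" "\<And>p. p \<in> Omega \<Longrightarrow> \<bar>w p\<bar> \<le> B"
proof -
  have "compact (w ` ({0..1} \<times> {0..1}))"
    using assms by (intro compact_continuous_image compact_Times compact_Icc) (auto intro: continuous_on_subset)
  then obtain B where "B > 0" "\<And>z. z \<in> w ` ({0..1} \<times> {0..1}) \<Longrightarrow> norm z \<le> B"
    using compact_imp_bounded bounded_pos by metis
  then show thesis
    by (intro that[of B]) (auto simp: Omega_def)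
qed

lemma continuous_lebesgue_measurable:
  "continuous_on UNIV w \<Longrightarrow> w \<in> borel_measurable lebesgue" for w :: "real \<times> real \<Rightarrow> real"
  by (intro borel_measurable_lebesgueI borel_measurable_continuous_onI)

lemma set_integrable_mult_continuous:
  fixes v w :: "real \<times> real \<Rightarrow> real"
  assumes "set_integrable lebesgue Omega v" "continuous_on UNIV w"
  shows "set_integrable lebesgue Omega (\<lambda>p. v p * w p)"
proof -
  obtain B where "\<And>p. p \<in> Omega \<Longrightarrow> \<bar>w p\<bar> \<le> B"
    using continuous_bounded_Omega[OF assms(2)] by metis
  then show ?thesis
    by (intro set_integrable_mult_bounded[OF assms(1) Omega_sets] continuous_lebesgue_measurable assms(2))
qed

section \<open>Zero traces as averages over strips\<close>

text \<open>Common form of the four trace conditions, with \<open>S s\<close> the strip of width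
  \<open>s\<close> along one side, so that limits are taken once and not side by side.\<close>

definition strip_trace0 :: "(real \<Rightarrow> (real \<times> real) set) \<Rightarrow> ((real \<times> real) \<Rightarrow> real) \<Rightarrow> bool" where
  "strip_trace0 S w \<longleftrightarrow> ((\<lambda>s. (1 / s) * (LINT p:S s|lebesgue. \<bar>w p\<bar>)) \<longlongrightarrow> 0) (at_right 0)"

text \<open>The last clause says that the strips eventually leave every point of
  \<open>Omega\<close>; by dominated convergence the mass of an integrable function on them then
  tends to 0.\<close>

definition strip :: "(real \<Rightarrow> (real \<times> real) set) \<Rightarrow> bool" where
  "strip S \<longleftrightarrow> (\<forall>s. S s \<in> sets lebesgue) \<and> (\<forall>s. 0 < s \<longrightarrow> s < 1 \<longrightarrow> S s \<subseteq> Omega) \<and>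
     (\<forall>p\<in>Omega. \<forall>\<^sub>F s in at_right 0. p \<notin> S s)"

lemma strip_trace0_mult:
  fixes v psi :: "real \<times> real \<Rightarrow> real"
  assumes S: "strip S" and v: "set_integrable lebesgue Omega v" and psi: "continuous_on UNIV psi"
    and tr: "strip_trace0 S v"
  shows "strip_trace0 S (\<lambda>p. v p * psi p)"
proof -
  obtain B where B: "B > 0" "\<And>p. p \<in> Omega \<Longrightarrow> \<bar>psi p\<bar> \<le> B"
    using continuous_bounded_Omega[OF psi] by metis
  have lim: "((\<lambda>s. B * ((1 / s) * (LINT p:S s|lebesgue. \<bar>v p\<bar>))) \<longlongrightarrow> 0) (at_right 0)"
    using tendsto_mult_right_zero[OF tr[unfolded strip_trace0_def]] .
  have "\<forall>\<^sub>F s in at_right (0::real). 0 < s \<and> s < 1"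
    by (intro eventually_conj eventually_at_right_less order_tendstoD(2)[OF tendsto_ident_at]) auto
  then have "\<forall>\<^sub>F s in at_right 0. norm ((1 / s) * (LINT p:S s|lebesgue. \<bar>v p * psi p\<bar>)) \<le> B * ((1 / s) * (LINT p:S s|lebesgue. \<bar>v p\<bar>))"
  proof eventually_elim
    case (elim s)
    have sub: "S s \<subseteq> Omega" "S s \<in> sets lebesgue" using S elim by (auto simp: strip_def)
    have vS: "set_integrable lebesgue (S s) v" by (rule set_integrable_subset[OF v]) (use sub in auto)
    have "\<bar>LINT p:S s|lebesgue. \<bar>v p\<bar> * \<bar>psi p\<bar>\<bar> \<le> B * (LINT p:S s|lebesgue. \<bar>\<bar>v p\<bar>\<bar>)"
      using B sub psi by (intro set_integral_mult_bounded set_integrable_abs vS continuous_lebesgue_measurable continuous_intros) auto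
    then have "\<bar>LINT p:S s|lebesgue. \<bar>v p * psi p\<bar>\<bar> \<le> B * (LINT p:S s|lebesgue. \<bar>v p\<bar>)"
      by (simp add: abs_mult)
    then have "(1 / s) * \<bar>LINT p:S s|lebesgue. \<bar>v p * psi p\<bar>\<bar> \<le> (1 / s) * (B * (LINT p:S s|lebesgue. \<bar>v p\<bar>))"
      using elim by (intro mult_left_mono) auto
    then show ?case using elim by (simp add: abs_mult algebra_simps)
  qed
  then show ?thesis
    unfolding strip_trace0_def by (rule Lim_null_comparison) (rule lim)
qed

text \<open>The second way for a boundary term to disappear, used where \<open>v\<close> has no
  known trace: the linear vanishing of \<open>psi\<close> cancels the factor \<open>1 / s\<close>,
  and what remains is \<open>C\<close> times the mass of \<open>v\<close> on the strip, which tends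
  to 0.\<close>

lemma strip_trace0_mult_vanishing:
  fixes v psi :: "real \<times> real \<Rightarrow> real"
  assumes S: "strip S" and v: "set_integrable lebesgue Omega v" and psi: "continuous_on UNIV psi"
    and van: "\<And>s p. 0 < s \<Longrightarrow> s < 1 \<Longrightarrow> p \<in> S s \<Longrightarrow> \<bar>psi p\<bar> \<le> C * s"
  shows "strip_trace0 S (\<lambda>p. v p * psi p)"
proof -
  have "((\<lambda>s. LINT p:S s|lebesgue. \<bar>v p\<bar>) \<longlongrightarrow> 0) (at_right 0)"
  \<comment> \<open>Dominated convergence is available along sequences, so the one-sided limit is
    tested on sequences decreasing to 0.\<close>
  proof (rule tendsto_at_right_sequentially[of 0 1])
    fix X :: "nat \<Rightarrow> real"
    assume X: "\<And>n. 0 < X n" "\<And>n. X n < 1" "decseq X" "X \<longlonglongrightarrow> 0"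
    have fl: "filterlim X (at_right 0) sequentially"
      using X(1,4) by (auto simp: filterlim_at less_imp_neq[symmetric] intro!: always_eventually)
    have "(\<lambda>n. LINT p:Omega|lebesgue. \<bar>v p\<bar> * indicator (S (X n)) p) \<longlonglongrightarrow> (LINT p:Omega|lebesgue. \<bar>v p\<bar> * 0)"
    proof (rule set_integral_mult_tendsto[OF set_integrable_abs[OF v] Omega_sets])
      show "indicat_real (S (X n)) \<in> borel_measurable lebesgue" for n
        using S by (intro borel_measurable_indicator) (auto simp: strip_def)
      show "\<bar>indicat_real (S (X n)) p\<bar> \<le> 1" for n p by simp
      have "(\<lambda>n. indicat_real (S (X n)) p) \<longlonglongrightarrow> 0" if "p \<in> Omega" for p
      proof (rule tendsto_eventually)
        have "\<forall>\<^sub>F s in at_right 0. p \<notin> S s" using S that by (auto simp: strip_def)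
        then have "\<forall>\<^sub>F n in sequentially. p \<notin> S (X n)"
          by (rule eventually_compose_filterlim[OF _ fl])
        then show "\<forall>\<^sub>F n in sequentially. indicat_real (S (X n)) p = 0"
          by eventually_elim simp
      qed
      then show "AE p in lebesgue. p \<in> Omega \<longrightarrow> (\<lambda>n. indicat_real (S (X n)) p) \<longlonglongrightarrow> 0" by simp
    qed auto
    moreover have "(LINT p:Omega|lebesgue. \<bar>v p\<bar> * indicator (S (X n)) p) = (LINT p:S (X n)|lebesgue. \<bar>v p\<bar>)" for n
    proof -
      have "S (X n) \<subseteq> Omega" using S X by (auto simp: strip_def)
      then show ?thesis
        unfolding set_lebesgue_integral_def by (intro Bochner_Integration.integral_cong) (auto simp: indicator_def)
    qed
    ultimately show "(\<lambda>n. LINT p:S (X n)|lebesgue. \<bar>v p\<bar>) \<longlonglongrightarrow> 0" by simp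
  qed simp
  then have lim: "((\<lambda>s. C * (LINT p:S s|lebesgue. \<bar>v p\<bar>)) \<longlongrightarrow> 0) (at_right 0)"
    by (rule tendsto_mult_right_zero)
  have "\<forall>\<^sub>F s in at_right (0::real). 0 < s \<and> s < 1"
    by (intro eventually_conj eventually_at_right_less order_tendstoD(2)[OF tendsto_ident_at]) auto
  then have "\<forall>\<^sub>F s in at_right 0. norm ((1 / s) * (LINT p:S s|lebesgue. \<bar>v p * psi p\<bar>)) \<le> C * (LINT p:S s|lebesgue. \<bar>v p\<bar>)"
  proof eventually_elim
    case (elim s)
    have sub: "S s \<subseteq> Omega" "S s \<in> sets lebesgue" using S elim by (auto simp: strip_def)
    have vS: "set_integrable lebesgue (S s) v" by (rule set_integrable_subset[OF v]) (use sub in auto)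
    have "\<bar>LINT p:S s|lebesgue. \<bar>v p\<bar> * \<bar>psi p\<bar>\<bar> \<le> (C * s) * (LINT p:S s|lebesgue. \<bar>\<bar>v p\<bar>\<bar>)"
      using sub psi van elim by (intro set_integral_mult_bounded set_integrable_abs vS continuous_lebesgue_measurable continuous_intros) auto
    then have "\<bar>LINT p:S s|lebesgue. \<bar>v p * psi p\<bar>\<bar> \<le> (C * s) * (LINT p:S s|lebesgue. \<bar>v p\<bar>)"
      by (simp add: abs_mult)
    then show ?case using elim by (simp add: abs_mult field_simps)
  qed
  then show ?thesis
    unfolding strip_trace0_def by (rule Lim_null_comparison) (rule lim)
qed

section \<open>Integration by parts up to the boundary\<close>

text \<open>Here \<open>th s\<close> is the cutoff, \<open>th' s\<close> its derivative in the
  chosen direction, and \<open>ibp\<close> the definition of the weak derivative tested with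
  \<open>psi * th s\<close>. As \<open>s\<close> tends to 0 the term with \<open>th'\<close> is
  controlled by the two strip averages and vanishes. Leaving the direction open lets one argument
  serve \<open>x\<close> and \<open>y\<close>.\<close>

lemma integration_by_parts_limit:
  fixes v v' psi psi' :: "real \<times> real \<Rightarrow> real"
  assumes v: "set_integrable lebesgue Omega v" and v': "set_integrable lebesgue Omega v'"
    and psi: "continuous_on UNIV psi" and psi': "continuous_on UNIV psi'"
    and S1: "strip S1" and S2: "strip S2"
    and tr1: "strip_trace0 S1 (\<lambda>p. v p * psi p)" and tr2: "strip_trace0 S2 (\<lambda>p. v p * psi p)"
    and th: "\<And>s. continuous_on UNIV (th s)" and th': "\<And>s. continuous_on UNIV (th' s)"
    and th_bound: "\<And>s p. \<bar>th s p\<bar> \<le> 1"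
    and th_lim: "\<And>p. p \<in> Omega \<Longrightarrow> ((\<lambda>s. th s p) \<longlongrightarrow> 1) (at_right 0)"
    and th'_bound: "\<And>s p. 0 < s \<Longrightarrow> s < 1 \<Longrightarrow> p \<in> Omega \<Longrightarrow> \<bar>th' s p\<bar> \<le> 3 / s * (indicator (S1 s) p + indicator (S2 s) p)"
    and ibp: "\<And>s. 0 < s \<Longrightarrow> (LINT p:Omega|lebesgue. v p * (psi' p * th s p + psi p * th' s p)) =
       - (LINT p:Omega|lebesgue. v' p * (psi p * th s p))"
  shows "(LINT p:Omega|lebesgue. v' p * psi p) = - (LINT p:Omega|lebesgue. v p * psi' p)"
proof -
  \<comment> \<open>The shift by 2 gives \<open>X n < 1\<close> already at \<open>n = 0\<close>, as
    the strips and the bound on \<open>th'\<close> require.\<close>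
  define X where "X = (\<lambda>n. 1 / real (n + 2))"
  have X: "0 < X n" "X n < 1" for n by (auto simp: X_def)
  have "X \<longlonglongrightarrow> 0"
    using LIMSEQ_ignore_initial_segment[OF lim_1_over_n, of 2] by (simp add: X_def)
  then have fl: "filterlim X (at_right 0) sequentially"
    using X(1) by (auto simp: filterlim_at less_imp_neq[symmetric] intro!: always_eventually)
  have vpsi: "set_integrable lebesgue Omega (\<lambda>p. v p * psi p)" by (rule set_integrable_mult_continuous[OF v psi])
  have v'psi: "set_integrable lebesgue Omega (\<lambda>p. v' p * psi p)" by (rule set_integrable_mult_continuous[OF v' psi])
  have vpsi': "set_integrable lebesgue Omega (\<lambda>p. v p * psi' p)" by (rule set_integrable_mult_continuous[OF v psi'])
  have lim: "(\<lambda>n. LINT p:Omega|lebesgue. g p * th (X n) p) \<longlonglongrightarrow> (LINT p:Omega|lebesgue. g p * 1)"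
    if "set_integrable lebesgue Omega g" for g
    using th_bound filterlim_compose[OF th_lim fl]
    by (intro set_integral_mult_tendsto[OF that Omega_sets, where B=1] continuous_lebesgue_measurable th) auto
  have bdry: "(\<lambda>n. LINT p:Omega|lebesgue. (v p * psi p) * th' (X n) p) \<longlonglongrightarrow> 0"
  proof (rule Lim_null_comparison)
    let ?m = "\<lambda>S s. (1 / s) * (LINT p:S s|lebesgue. \<bar>v p * psi p\<bar>)"
    show "\<forall>\<^sub>F n in sequentially. norm (LINT p:Omega|lebesgue. (v p * psi p) * th' (X n) p) \<le> 3 * (?m S1 (X n) + ?m S2 (X n))"
    proof (intro always_eventually allI)
      fix n
      have sub: "S1 (X n) \<subseteq> Omega" "S1 (X n) \<in> sets lebesgue" "S2 (X n) \<subseteq> Omega" "S2 (X n) \<in> sets lebesgue"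
        using S1 S2 X by (auto simp: strip_def)
      have restr: "(LINT p:Omega|lebesgue. \<bar>v p * psi p\<bar> * indicator S p) = (LINT p:S|lebesgue. \<bar>v p * psi p\<bar>)"
        if "S \<subseteq> Omega" for S
        unfolding set_lebesgue_integral_def using that by (intro Bochner_Integration.integral_cong) (auto simp: indicator_def)
      have ind_int: "set_integrable lebesgue Omega (\<lambda>p. \<bar>v p * psi p\<bar> * indicator S p)" if "S \<in> sets lebesgue" for S
        using that by (intro set_integrable_mult_bounded[where B=1] set_integrable_abs vpsi Omega_sets borel_measurable_indicator) auto
      have "norm (LINT p:Omega|lebesgue. (v p * psi p) * th' (X n) p) \<le> (LINT p:Omega|lebesgue. \<bar>(v p * psi p) * th' (X n) p\<bar>)"
        unfolding real_norm_def by (rule set_integral_abs_bound)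
      also have "\<dots> \<le> (LINT p:Omega|lebesgue. 3 / X n * (\<bar>v p * psi p\<bar> * indicator (S1 (X n)) p + \<bar>v p * psi p\<bar> * indicator (S2 (X n)) p))"
      proof (rule set_integral_mono)
        show "set_integrable lebesgue Omega (\<lambda>p. \<bar>v p * psi p * th' (X n) p\<bar>)"
          by (intro set_integrable_abs set_integrable_mult_continuous[OF vpsi th'])
        show "set_integrable lebesgue Omega (\<lambda>p. 3 / X n * (\<bar>v p * psi p\<bar> * indicator (S1 (X n)) p + \<bar>v p * psi p\<bar> * indicator (S2 (X n)) p))"
          using sub by (intro set_integrable_mult_right set_integral_add(1) ind_int) auto
        fix p assume "p \<in> Omega"
        then have "\<bar>v p * psi p\<bar> * \<bar>th' (X n) p\<bar> \<le> \<bar>v p * psi p\<bar> * (3 / X n * (indicator (S1 (X n)) p + indicator (S2 (X n)) p))"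
          by (intro mult_left_mono th'_bound X) auto
        then show "\<bar>v p * psi p * th' (X n) p\<bar> \<le> 3 / X n * (\<bar>v p * psi p\<bar> * indicator (S1 (X n)) p + \<bar>v p * psi p\<bar> * indicator (S2 (X n)) p)"
          by (simp add: abs_mult algebra_simps)
      qed
      also have "\<dots> = 3 / X n * ((LINT p:S1 (X n)|lebesgue. \<bar>v p * psi p\<bar>) + (LINT p:S2 (X n)|lebesgue. \<bar>v p * psi p\<bar>))"
        unfolding set_integral_mult_right using sub by (subst set_integral_add(2)) (simp_all only: ind_int restr)
      finally show "norm (LINT p:Omega|lebesgue. (v p * psi p) * th' (X n) p) \<le> 3 * (?m S1 (X n) + ?m S2 (X n))"
        by (simp add: algebra_simps)
    qed
    have "(\<lambda>n. 3 * (?m S1 (X n) + ?m S2 (X n))) \<longlonglongrightarrow> 3 * (0 + 0)"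
      using filterlim_compose[OF tr1[unfolded strip_trace0_def] fl] filterlim_compose[OF tr2[unfolded strip_trace0_def] fl]
      by (intro tendsto_intros)
    then show "(\<lambda>n. 3 * (?m S1 (X n) + ?m S2 (X n))) \<longlonglongrightarrow> 0" by simp
  qed
  have eq: "(LINT p:Omega|lebesgue. (v p * psi' p) * th (X n) p) + (LINT p:Omega|lebesgue. (v p * psi p) * th' (X n) p)
     = - (LINT p:Omega|lebesgue. (v' p * psi p) * th (X n) p)" for n
  proof -
    have "(LINT p:Omega|lebesgue. (v p * psi' p) * th (X n) p) + (LINT p:Omega|lebesgue. (v p * psi p) * th' (X n) p) =
       (LINT p:Omega|lebesgue. (v p * psi' p) * th (X n) p + (v p * psi p) * th' (X n) p)"
      by (intro set_integral_add(2)[symmetric] set_integrable_mult_continuous vpsi vpsi' th th')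
    also have "\<dots> = (LINT p:Omega|lebesgue. v p * (psi' p * th (X n) p + psi p * th' (X n) p))"
      by (simp add: algebra_simps)
    also have "\<dots> = - (LINT p:Omega|lebesgue. v' p * (psi p * th (X n) p))"
      by (rule ibp) (rule X)
    finally show ?thesis by (simp add: mult.assoc)
  qed
  have "(\<lambda>n. (LINT p:Omega|lebesgue. (v p * psi' p) * th (X n) p) + (LINT p:Omega|lebesgue. (v p * psi p) * th' (X n) p))
     \<longlonglongrightarrow> (LINT p:Omega|lebesgue. (v p * psi' p) * 1) + 0"
    by (intro tendsto_add lim vpsi' bdry)
  moreover have "(\<lambda>n. - (LINT p:Omega|lebesgue. (v' p * psi p) * th (X n) p)) \<longlonglongrightarrow> - (LINT p:Omega|lebesgue. (v' p * psi p) * 1)"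
    by (intro tendsto_minus lim v'psi)
  ultimately have "(LINT p:Omega|lebesgue. (v p * psi' p) * 1) + 0 = - (LINT p:Omega|lebesgue. (v' p * psi p) * 1)"
    unfolding eq by (rule LIMSEQ_unique)
  then show ?thesis by simp
qed

lemma strips:
  shows strip_x0: "strip (\<lambda>s. {0<..<s} \<times> {0<..<1})" and strip_x1: "strip (\<lambda>s. {1-s<..<1} \<times> {0<..<1})"
    and strip_y0: "strip (\<lambda>s. {0<..<1} \<times> {0<..<s})" and strip_y1: "strip (\<lambda>s. {0<..<1} \<times> {1-s<..<1})"
proof -
  have meas: "{a<..<b} \<times> {c<..<d} \<in> sets lebesgue" for a b c d :: real
  proof -
    have "open ({a<..<b} \<times> {c<..<d})" by (intro open_Times open_greaterThanLessThan)
    then show ?thesis by simp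
  qed
  have ev: "\<forall>\<^sub>F s in at_right 0. s < x" if "0 < x" for x :: real
    using that by (intro order_tendstoD(2)[OF tendsto_ident_at]) auto
  have ev': "\<forall>\<^sub>F s in at_right 0. \<not> x < s" if "0 < x" for x :: real
    using ev[OF that] by eventually_elim auto
  have ev1: "\<forall>\<^sub>F s in at_right 0. \<not> 1 - s < x" if "x < 1" for x :: real
    using ev[of "1 - x"] that by (auto elim: eventually_mono)
  show "strip (\<lambda>s. {0<..<s} \<times> {0<..<1})"
    using meas ev' unfolding strip_def Omega_def by auto
  show "strip (\<lambda>s. {1-s<..<1} \<times> {0<..<1})"
    using meas ev1 unfolding strip_def Omega_def by auto
  show "strip (\<lambda>s. {0<..<1} \<times> {0<..<s})"
    using meas ev' unfolding strip_def Omega_def by auto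
  show "strip (\<lambda>s. {0<..<1} \<times> {1-s<..<1})"
    using meas ev1 unfolding strip_def Omega_def by auto
qed

lemma C1_fun_cutoff:
  "C1_fun (\<lambda>p. cutoff s (fst p) * cutoff s (snd p)) (\<lambda>p. cutoff' s (fst p) * cutoff s (snd p))
     (\<lambda>p. cutoff s (fst p) * cutoff' s (snd p))"
  by (intro C1_fun_prod cutoff_deriv continuous_on_cutoff')

text \<open>Compact support forces a cutoff in both variables, but the x-derivative falls on the
  factor in \<open>x\<close> alone, so only the sides \<open>x = 0\<close> and \<open>x = 1\<close>
  contribute boundary terms.\<close>

lemma weak_dx_integration_by_parts:
  assumes v: "set_integrable lebesgue Omega v" and vx: "set_integrable lebesgue Omega vx" and w: "weak_dx v vx"
    and psi: "C1_fun psi psix psiy"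
    and tr: "trace0_x0 (\<lambda>p. v p * psi p)" "trace0_x1 (\<lambda>p. v p * psi p)"
  shows "(LINT p:Omega|lebesgue. vx p * psi p) = - (LINT p:Omega|lebesgue. v p * psix p)"
proof (rule integration_by_parts_limit[OF v vx _ _ strip_x0 strip_x1,
    where th="\<lambda>s p. cutoff s (fst p) * cutoff s (snd p)" and th'="\<lambda>s p. cutoff' s (fst p) * cutoff s (snd p)"])
  show "continuous_on UNIV psi" "continuous_on UNIV psix"
    using psi C1_fun_continuous[OF psi] unfolding C1_fun_def by auto
  show "strip_trace0 (\<lambda>s. {0<..<s} \<times> {0<..<1}) (\<lambda>p. v p * psi p)" "strip_trace0 (\<lambda>s. {1-s<..<1} \<times> {0<..<1}) (\<lambda>p. v p * psi p)"
    using tr unfolding strip_trace0_def trace0_x0_def trace0_x1_def by auto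
  show "continuous_on UNIV (\<lambda>p::real\<times>real. cutoff s (fst p) * cutoff s (snd p))"
    "continuous_on UNIV (\<lambda>p::real\<times>real. cutoff' s (fst p) * cutoff s (snd p))" for s
    using C1_fun_cutoff[of s] C1_fun_continuous[OF C1_fun_cutoff[of s]] unfolding C1_fun_def by auto
  show "\<bar>cutoff s (fst p) * cutoff s (snd p)\<bar> \<le> 1" for s and p :: "real \<times> real"
    using cutoff_range[of s] by (auto simp: abs_mult intro: mult_le_one)
  show "((\<lambda>s. cutoff s (fst p) * cutoff s (snd p)) \<longlongrightarrow> 1) (at_right 0)" if "p \<in> Omega" for p
    using tendsto_mult[OF cutoff_tendsto[of "fst p"] cutoff_tendsto[of "snd p"]] that by (auto simp: Omega_def)
  show "\<bar>cutoff' s (fst p) * cutoff s (snd p)\<bar> \<le> 3 / s * (indicator ({0<..<s} \<times> {0<..<1}) p + indicator ({1-s<..<1} \<times> {0<..<1}) p)"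
    if "0 < s" "p \<in> Omega" for s p
  proof -
    have "\<bar>cutoff' s (fst p) * cutoff s (snd p)\<bar> \<le> \<bar>cutoff' s (fst p)\<bar>"
      using cutoff_range[of s "snd p"] by (simp add: abs_mult mult_left_le)
    also have "\<dots> \<le> 3 / s * (indicator {..<s} (fst p) + indicator {1 - s<..} (fst p))"
      by (rule cutoff'_bound) fact
    also have "\<dots> = 3 / s * (indicator ({0<..<s} \<times> {0<..<1}) p + indicator ({1-s<..<1} \<times> {0<..<1}) p)"
      using that by (auto simp: indicator_def Omega_def)
    finally show ?thesis .
  qed
  show "(LINT p:Omega|lebesgue. v p * (psix p * (cutoff s (fst p) * cutoff s (snd p)) + psi p * (cutoff' s (fst p) * cutoff s (snd p)))) =
     - (LINT p:Omega|lebesgue. vx p * (psi p * (cutoff s (fst p) * cutoff s (snd p))))" if "0 < s" for s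
    using w test_fun_cutoff[OF psi that] unfolding weak_dx_def by blast
qed

lemma weak_dy_integration_by_parts:
  assumes v: "set_integrable lebesgue Omega v" and vy: "set_integrable lebesgue Omega vy" and w: "weak_dy v vy"
    and psi: "C1_fun psi psix psiy"
    and tr: "trace0_y0 (\<lambda>p. v p * psi p)" "trace0_y1 (\<lambda>p. v p * psi p)"
  shows "(LINT p:Omega|lebesgue. vy p * psi p) = - (LINT p:Omega|lebesgue. v p * psiy p)"
proof (rule integration_by_parts_limit[OF v vy _ _ strip_y0 strip_y1,
    where th="\<lambda>s p. cutoff s (fst p) * cutoff s (snd p)" and th'="\<lambda>s p. cutoff s (fst p) * cutoff' s (snd p)"])
  show "continuous_on UNIV psi" "continuous_on UNIV psiy"
    using psi C1_fun_continuous[OF psi] unfolding C1_fun_def by auto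
  show "strip_trace0 (\<lambda>s. {0<..<1} \<times> {0<..<s}) (\<lambda>p. v p * psi p)" "strip_trace0 (\<lambda>s. {0<..<1} \<times> {1-s<..<1}) (\<lambda>p. v p * psi p)"
    using tr unfolding strip_trace0_def trace0_y0_def trace0_y1_def by auto
  show "continuous_on UNIV (\<lambda>p::real\<times>real. cutoff s (fst p) * cutoff s (snd p))"
    "continuous_on UNIV (\<lambda>p::real\<times>real. cutoff s (fst p) * cutoff' s (snd p))" for s
    using C1_fun_cutoff[of s] C1_fun_continuous[OF C1_fun_cutoff[of s]] unfolding C1_fun_def by auto
  show "\<bar>cutoff s (fst p) * cutoff s (snd p)\<bar> \<le> 1" for s and p :: "real \<times> real"
    using cutoff_range[of s] by (auto simp: abs_mult intro: mult_le_one)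
  show "((\<lambda>s. cutoff s (fst p) * cutoff s (snd p)) \<longlongrightarrow> 1) (at_right 0)" if "p \<in> Omega" for p
    using tendsto_mult[OF cutoff_tendsto[of "fst p"] cutoff_tendsto[of "snd p"]] that by (auto simp: Omega_def)
  show "\<bar>cutoff s (fst p) * cutoff' s (snd p)\<bar> \<le> 3 / s * (indicator ({0<..<1} \<times> {0<..<s}) p + indicator ({0<..<1} \<times> {1-s<..<1}) p)"
    if "0 < s" "p \<in> Omega" for s p
  proof -
    have "\<bar>cutoff s (fst p) * cutoff' s (snd p)\<bar> \<le> \<bar>cutoff' s (snd p)\<bar>"
      using cutoff_range[of s "fst p"] by (simp add: abs_mult mult_left_le_one_le)
    also have "\<dots> \<le> 3 / s * (indicator {..<s} (snd p) + indicator {1 - s<..} (snd p))"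
      by (rule cutoff'_bound) fact
    also have "\<dots> = 3 / s * (indicator ({0<..<1} \<times> {0<..<s}) p + indicator ({0<..<1} \<times> {1-s<..<1}) p)"
      using that by (auto simp: indicator_def Omega_def)
    finally show ?thesis .
  qed
  show "(LINT p:Omega|lebesgue. v p * (psiy p * (cutoff s (fst p) * cutoff s (snd p)) + psi p * (cutoff s (fst p) * cutoff' s (snd p)))) =
     - (LINT p:Omega|lebesgue. vy p * (psi p * (cutoff s (fst p) * cutoff s (snd p))))" if "0 < s" for s
    using w test_fun_cutoff[OF psi that] unfolding weak_dy_def by blast
qed

text \<open>\<open>Omega\<close> has finite measure and \<open>|z| \<le> 1 + z^2\<close>.
  Measurability is taken from its own clause in \<open>L2_on\<close>, since that of the square would
  not give it.\<close>

lemma L2_on_Omega_imp_integrable: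
  assumes "L2_on Omega f" shows "set_integrable lebesgue Omega f"
proof -
  have m: "f \<in> borel_measurable (lebesgue_on Omega)" and sq: "set_integrable lebesgue Omega (\<lambda>p. (f p)\<^sup>2)"
    using assms by (auto simp: L2_on_def)
  have m': "(\<lambda>p. indicat_real Omega p *\<^sub>R f p) \<in> borel_measurable lebesgue"
    using m Omega_sets borel_measurable_restrict_space_iff[of Omega lebesgue f] by simp
  have "bounded Omega" unfolding Omega_def by (intro bounded_Times) auto
  then have fin: "Omega \<in> lmeasurable"
    by (simp add: Omega_sets bounded_set_imp_lmeasurable)
  have one: "set_integrable lebesgue Omega (\<lambda>p. 1 :: real)"
    unfolding set_integrable_def real_scaleR_def mult_1_right
    using fin by (intro integrable_real_indicator) (auto simp: fmeasurable_def)
  have "set_integrable lebesgue Omega (\<lambda>p. 1 + (f p)\<^sup>2)"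
    by (rule set_integral_add(1)[OF one sq])
  then show ?thesis
    unfolding set_integrable_def
  proof (rule Bochner_Integration.integrable_bound)
    have "\<bar>z\<bar> \<le> 1 + z\<^sup>2" for z :: real
    proof -
      have "0 \<le> (\<bar>z\<bar> - 1)\<^sup>2" by simp
      then have "2 * \<bar>z\<bar> \<le> 1 + z\<^sup>2" by (simp add: power2_eq_square algebra_simps)
      then show ?thesis by linarith
    qed
    then have "\<bar>z\<bar> \<le> \<bar>1 + z\<^sup>2\<bar>" for z :: real
      using abs_ge_self order_trans by blast
    then show "AE p in lebesgue. norm (indicat_real Omega p *\<^sub>R f p) \<le> norm (indicat_real Omega p *\<^sub>R (1 + (f p)\<^sup>2))"
      by (intro AE_I2) (auto simp: abs_mult mult_left_mono)
  qed (rule m')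
qed

text \<open>Mean value inequality. The linear rate is what cancels the factor \<open>1 / s\<close>
  in the strip averages.\<close>

lemma C1_zero_imp_linear_bound:
  fixes F F' :: "real \<Rightarrow> real"
  assumes F: "\<And>x. (F has_real_derivative F' x) (at x)" and F': "continuous_on UNIV F'"
    and c: "F c = 0" "c \<in> {0..1}"
  obtains C where "C \<ge> 0" "\<And>x. x \<in> {0..1} \<Longrightarrow> \<bar>F x\<bar> \<le> C * \<bar>x - c\<bar>"
proof -
  have "compact (F' ` {0..1})"
    using F' by (intro compact_continuous_image compact_Icc) (auto intro: continuous_on_subset)
  then obtain C where C: "C > 0" "\<And>z. z \<in> F' ` {0..1} \<Longrightarrow> norm z \<le> C"
    using compact_imp_bounded bounded_pos by metis
  have "norm (F x - F c) \<le> C * norm (x - c)" if "x \<in> {0..1}" for x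
    using F C c that
    by (intro field_differentiable_bound[of "{0..1}" F F']) (auto intro: has_field_derivative_at_within)
  with C c show thesis by (intro that[of C]) auto
qed

text \<open>Covers the three sides on which \<open>u\<close> itself is unknown: there the derivative
  of the weight vanishes, as \<open>sinh (a x)\<close> at \<open>x = 0\<close> and
  \<open>sin (n pi y)\<close> at \<open>y = 0\<close> and \<open>y = 1\<close>. On
  \<open>x = 1\<close> the zero trace of \<open>u\<close> does the work.\<close>

lemma trace0_prod_vanishing:
  fixes F F' G :: "real \<Rightarrow> real"
  assumes v: "set_integrable lebesgue Omega v"
    and F: "\<And>x. (F has_real_derivative F' x) (at x)" and F': "continuous_on UNIV F'"
    and G: "continuous_on UNIV G"
  shows "F 0 = 0 \<Longrightarrow> trace0_x0 (\<lambda>p. v p * (F (fst p) * G (snd p)))"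
    and "F 0 = 0 \<Longrightarrow> trace0_y0 (\<lambda>p. v p * (G (fst p) * F (snd p)))"
    and "F 1 = 0 \<Longrightarrow> trace0_y1 (\<lambda>p. v p * (G (fst p) * F (snd p)))"
proof -
  have cF: "continuous_on UNIV F" using F by (meson DERIV_isCont continuous_at_imp_continuous_on)
  have comp: "continuous_on UNIV (\<lambda>p::real\<times>real. K (fst p))" "continuous_on UNIV (\<lambda>p::real\<times>real. K (snd p))"
    if "continuous_on UNIV K" for K :: "real \<Rightarrow> real"
    by (rule continuous_on_compose2[OF that]; intro continuous_intros subset_UNIV)+
  have "compact (G ` {0..1})"
    using G by (intro compact_continuous_image compact_Icc) (auto intro: continuous_on_subset)
  then obtain B where B: "B > 0" "\<And>y. y \<in> {0..1} \<Longrightarrow> \<bar>G y\<bar> \<le> B"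
    using compact_imp_bounded bounded_pos by (metis imageI real_norm_def)
  have bd: "\<bar>F x * G y\<bar> \<le> (C * B) * s"
    if "\<And>x. x \<in> {0..1} \<Longrightarrow> \<bar>F x\<bar> \<le> C * \<bar>x - c\<bar>" "x \<in> {0..1}" "y \<in> {0..1}" "\<bar>x - c\<bar> \<le> s" "C \<ge> 0" for C c s x y
  proof -
    have "\<bar>F x\<bar> \<le> C * s" using that by (meson mult_left_mono order_trans)
    then have "\<bar>F x\<bar> * \<bar>G y\<bar> \<le> (C * s) * B" using B that by (intro mult_mono) auto
    then show ?thesis by (simp add: abs_mult mult_ac)
  qed
  show "trace0_x0 (\<lambda>p. v p * (F (fst p) * G (snd p)))" if z: "F 0 = 0"
  proof -
    obtain C where C: "C \<ge> 0" "\<And>x. x \<in> {0..1} \<Longrightarrow> \<bar>F x\<bar> \<le> C * \<bar>x - 0\<bar>"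
      using C1_zero_imp_linear_bound[OF F F' z] by auto
    have "strip_trace0 (\<lambda>s. {0<..<s} \<times> {0<..<1}) (\<lambda>p. v p * (F (fst p) * G (snd p)))"
    proof (rule strip_trace0_mult_vanishing[OF strip_x0 v])
      show "continuous_on UNIV (\<lambda>p::real\<times>real. F (fst p) * G (snd p))"
        by (intro continuous_on_mult comp cF G)
    qed (rule bd[OF C(2) _ _ _ C(1)], auto)
    then show ?thesis by (simp add: strip_trace0_def trace0_x0_def)
  qed
  show "trace0_y0 (\<lambda>p. v p * (G (fst p) * F (snd p)))" if z: "F 0 = 0"
  proof -
    obtain C where C: "C \<ge> 0" "\<And>x. x \<in> {0..1} \<Longrightarrow> \<bar>F x\<bar> \<le> C * \<bar>x - 0\<bar>"
      using C1_zero_imp_linear_bound[OF F F' z] by auto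
    have "strip_trace0 (\<lambda>s. {0<..<1} \<times> {0<..<s}) (\<lambda>p. v p * (F (snd p) * G (fst p)))"
    proof (rule strip_trace0_mult_vanishing[OF strip_y0 v])
      show "continuous_on UNIV (\<lambda>p::real\<times>real. F (snd p) * G (fst p))"
        by (intro continuous_on_mult comp cF G)
    qed (rule bd[OF C(2) _ _ _ C(1)], auto)
    then show ?thesis by (simp add: strip_trace0_def trace0_y0_def mult.commute)
  qed
  show "trace0_y1 (\<lambda>p. v p * (G (fst p) * F (snd p)))" if z: "F 1 = 0"
  proof -
    obtain C where C: "C \<ge> 0" "\<And>x. x \<in> {0..1} \<Longrightarrow> \<bar>F x\<bar> \<le> C * \<bar>x - 1\<bar>"
      using C1_zero_imp_linear_bound[OF F F' z] by auto
    have "strip_trace0 (\<lambda>s. {0<..<1} \<times> {1-s<..<1}) (\<lambda>p. v p * (F (snd p) * G (fst p)))"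
    proof (rule strip_trace0_mult_vanishing[OF strip_y1 v])
      show "continuous_on UNIV (\<lambda>p::real\<times>real. F (snd p) * G (fst p))"
        by (intro continuous_on_mult comp cF G)
    qed (rule bd[OF C(2) _ _ _ C(1)], auto)
    then show ?thesis by (simp add: strip_trace0_def trace0_y1_def mult.commute)
  qed
qed

section \<open>Green's formula for the weights\<close>

definition wave :: "real \<Rightarrow> nat \<Rightarrow> real \<times> real \<Rightarrow> real" where
  "wave a n p = cosh (a * fst p) * cos (real n * pi * snd p)"

lemma wave_continuous: "continuous_on UNIV (wave a n)"
  unfolding wave_def[abs_def] by (intro continuous_intros)

text \<open>Each second derivative is moved across in two integrations by parts. The boundary terms
  of the first vanish with the normal derivative of \<open>u\<close>; those of the second vanish
  with the normal derivative of the weight, except on \<open>x = 1\<close>, where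
  \<open>sinh a\<close> need not be zero and the trace of \<open>u\<close> is.\<close>

lemma Green_wave:
  assumes H2: "in_H2 u ux uy uxx uxy uyx uyy"
    and tr: "trace0_x0 ux" "trace0_x1 ux" "trace0_y0 uy" "trace0_y1 uy" "trace0_x1 u"
  shows "(LINT p:Omega|lebesgue. (uxx p + uyy p) * wave a n p) = (a\<^sup>2 - (real n * pi)\<^sup>2) * (LINT p:Omega|lebesgue. u p * wave a n p)"
proof -
  define b where "b = real n * pi"
  have int: "set_integrable lebesgue Omega u" "set_integrable lebesgue Omega ux" "set_integrable lebesgue Omega uy"
      "set_integrable lebesgue Omega uxx" "set_integrable lebesgue Omega uyy"
    using H2 by (auto simp: in_H2_def in_H1_def intro: L2_on_Omega_imp_integrable)
  have wk: "weak_dx u ux" "weak_dy u uy" "weak_dx ux uxx" "weak_dy uy uyy"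
    using H2 by (auto simp: in_H2_def in_H1_def)
  have ch: "((\<lambda>x. cosh (a * x)) has_real_derivative a * sinh (a * x)) (at x)"
    and sh: "((\<lambda>x. a * sinh (a * x)) has_real_derivative a\<^sup>2 * cosh (a * x)) (at x)"
    and co: "((\<lambda>y. cos (b * y)) has_real_derivative - b * sin (b * y)) (at y)"
    and si: "((\<lambda>y. - b * sin (b * y)) has_real_derivative - b\<^sup>2 * cos (b * y)) (at y)" for x y
    by (auto intro!: derivative_eq_intros simp: power2_eq_square)
  have cont: "continuous_on UNIV (\<lambda>x. a * sinh (a * x))" "continuous_on UNIV (\<lambda>x. a\<^sup>2 * cosh (a * x))"
    "continuous_on UNIV (\<lambda>y. - b * sin (b * y))" "continuous_on UNIV (\<lambda>y. - b\<^sup>2 * cos (b * y))"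
    "continuous_on UNIV (\<lambda>x. cosh (a * x))" "continuous_on UNIV (\<lambda>y. cos (b * y))"
    by (intro continuous_intros)+
  have w: "wave a n = (\<lambda>p. cosh (a * fst p) * cos (b * snd p))"
    by (simp add: fun_eq_iff wave_def b_def)
  note W = C1_fun_prod[OF ch co cont(1) cont(3)]
  note Wx = C1_fun_prod[OF sh co cont(2) cont(3)]
  note Wy = C1_fun_prod[OF ch si cont(1) cont(4)]
  \<comment> \<open>The integrality of \<open>n\<close> enters here: \<open>sin (n pi) = 0\<close>
    makes the weight satisfy the Neumann condition at \<open>y = 1\<close>.\<close>
  have "b * 1 = real n * pi" by (simp add: b_def)
  then have sin1: "- b * sin (b * 1) = 0" by simp
  have x1: "(LINT p:Omega|lebesgue. uxx p * wave a n p) = - (LINT p:Omega|lebesgue. ux p * (a * sinh (a * fst p) * cos (b * snd p)))"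
    unfolding w
  proof (rule weak_dx_integration_by_parts[OF int(2,4) wk(3) W])
    show "trace0_x0 (\<lambda>p. ux p * (cosh (a * fst p) * cos (b * snd p)))"
      using strip_trace0_mult[OF strip_x0 int(2) C1_fun_continuous[OF W]] tr(1) by (simp add: strip_trace0_def trace0_x0_def)
    show "trace0_x1 (\<lambda>p. ux p * (cosh (a * fst p) * cos (b * snd p)))"
      using strip_trace0_mult[OF strip_x1 int(2) C1_fun_continuous[OF W]] tr(2) by (simp add: strip_trace0_def trace0_x1_def)
  qed
  have x2: "(LINT p:Omega|lebesgue. ux p * (a * sinh (a * fst p) * cos (b * snd p))) = - (LINT p:Omega|lebesgue. u p * (a\<^sup>2 * cosh (a * fst p) * cos (b * snd p)))"
  proof (rule weak_dx_integration_by_parts[OF int(1,2) wk(1) Wx])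
    show "trace0_x0 (\<lambda>p. u p * (a * sinh (a * fst p) * cos (b * snd p)))"
      by (rule trace0_prod_vanishing(1)[OF int(1) sh cont(2) cont(6)]) simp
    show "trace0_x1 (\<lambda>p. u p * (a * sinh (a * fst p) * cos (b * snd p)))"
      using strip_trace0_mult[OF strip_x1 int(1) C1_fun_continuous[OF Wx]] tr(5) by (simp add: strip_trace0_def trace0_x1_def)
  qed
  have y1: "(LINT p:Omega|lebesgue. uyy p * wave a n p) = - (LINT p:Omega|lebesgue. uy p * (cosh (a * fst p) * (- b * sin (b * snd p))))"
    unfolding w
  proof (rule weak_dy_integration_by_parts[OF int(3,5) wk(4) W])
    show "trace0_y0 (\<lambda>p. uy p * (cosh (a * fst p) * cos (b * snd p)))"
      using strip_trace0_mult[OF strip_y0 int(3) C1_fun_continuous[OF W]] tr(3) by (simp add: strip_trace0_def trace0_y0_def)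
    show "trace0_y1 (\<lambda>p. uy p * (cosh (a * fst p) * cos (b * snd p)))"
      using strip_trace0_mult[OF strip_y1 int(3) C1_fun_continuous[OF W]] tr(4) by (simp add: strip_trace0_def trace0_y1_def)
  qed
  have y2: "(LINT p:Omega|lebesgue. uy p * (cosh (a * fst p) * (- b * sin (b * snd p)))) = - (LINT p:Omega|lebesgue. u p * (cosh (a * fst p) * (- b\<^sup>2 * cos (b * snd p))))"
  proof (rule weak_dy_integration_by_parts[OF int(1,3) wk(2) Wy])
    show "trace0_y0 (\<lambda>p. u p * (cosh (a * fst p) * (- b * sin (b * snd p))))"
      by (rule trace0_prod_vanishing(2)[OF int(1) si cont(4) cont(5)]) simp
    show "trace0_y1 (\<lambda>p. u p * (cosh (a * fst p) * (- b * sin (b * snd p))))"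
      by (rule trace0_prod_vanishing(3)[OF int(1) si cont(4) cont(5) sin1])
  qed
  have "(LINT p:Omega|lebesgue. (uxx p + uyy p) * wave a n p) =
      (LINT p:Omega|lebesgue. uxx p * wave a n p) + (LINT p:Omega|lebesgue. uyy p * wave a n p)"
    unfolding distrib_right by (intro set_integral_add(2) set_integrable_mult_continuous int wave_continuous)
  also have "\<dots> = (LINT p:Omega|lebesgue. a\<^sup>2 * (u p * wave a n p)) + (LINT p:Omega|lebesgue. - b\<^sup>2 * (u p * wave a n p))"
    unfolding x1 x2 y1 y2 minus_minus unfolding w by (simp only: mult_ac)
  also have "\<dots> = (a\<^sup>2 - b\<^sup>2) * (LINT p:Omega|lebesgue. u p * wave a n p)"
    unfolding set_integral_mult_right by (simp add: algebra_simps)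
  finally show ?thesis unfolding b_def .
qed

section \<open>Moments of solutions\<close>

text \<open>The weight is bounded by \<open>B\<close> on \<open>Omega\<close>, so the error of the
  difference quotient of the moment is at most \<open>B\<close> times that of \<open>u\<close> in
  the L1 norm.\<close>

lemma C1_L1_moment_derivative:
  assumes u: "C1_L1 T u u'" and w: "continuous_on UNIV w" and t: "t \<in> {0..T}"
  shows "((\<lambda>s. LINT p:Omega|lebesgue. u s p * w p) has_real_derivative (LINT p:Omega|lebesgue. u' t p * w p)) (at t within {0..T})"
proof -
  obtain B where B: "\<And>p. p \<in> Omega \<Longrightarrow> \<bar>w p\<bar> \<le> B"
    using continuous_bounded_Omega[OF w] by metis
  have int: "set_integrable lebesgue Omega (u s)" "set_integrable lebesgue Omega (u' s)" if "s \<in> {0..T}" for s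
    using u that by (auto simp: C1_L1_def L1_on_def)
  let ?m = "\<lambda>s. LINT p:Omega|lebesgue. u s p * w p" and ?d = "LINT p:Omega|lebesgue. u' t p * w p"
  have lim: "((\<lambda>s. L1_norm (\<lambda>p. (u s p - u t p) / (s - t) - u' t p)) \<longlongrightarrow> 0) (at t within {0..T})"
    using u t by (auto simp: C1_L1_def)
  have "((\<lambda>s. (?m s - ?m t) / (s - t) - ?d) \<longlongrightarrow> 0) (at t within {0..T})"
  proof (rule Lim_null_comparison)
    show "((\<lambda>s. B * L1_norm (\<lambda>p. (u s p - u t p) / (s - t) - u' t p)) \<longlongrightarrow> 0) (at t within {0..T})"
      by (rule tendsto_mult_right_zero[OF lim])
    have "\<bar>(?m s - ?m t) / (s - t) - ?d\<bar> \<le> B * L1_norm (\<lambda>p. (u s p - u t p) / (s - t) - u' t p)" if s: "s \<in> {0..T}" for s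
    proof -
      have q: "set_integrable lebesgue Omega (\<lambda>p. (u s p - u t p) / (s - t))"
        by (intro set_integrable_divide set_integral_diff(1) int s t)
      have "(?m s - ?m t) / (s - t) - ?d = (LINT p:Omega|lebesgue. ((u s p - u t p) / (s - t) - u' t p) * w p)"
      proof -
        have "(LINT p:Omega|lebesgue. ((u s p - u t p) / (s - t) - u' t p) * w p) =
            (LINT p:Omega|lebesgue. (u s p * w p - u t p * w p) / (s - t) - u' t p * w p)"
          by (simp add: left_diff_distrib diff_divide_distrib)
        also have "\<dots> = (LINT p:Omega|lebesgue. (u s p * w p - u t p * w p) / (s - t)) - ?d"
          by (intro set_integral_diff(2) set_integrable_divide set_integral_diff(1) set_integrable_mult_continuous int s t w)
        also have "(LINT p:Omega|lebesgue. (u s p * w p - u t p * w p) / (s - t)) = (?m s - ?m t) / (s - t)"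
          unfolding set_integral_divide_zero
          by (subst set_integral_diff(2)) (intro set_integrable_mult_continuous int s t w refl)+
        finally show ?thesis by simp
      qed
      also have "\<bar>\<dots>\<bar> \<le> B * (LINT p:Omega|lebesgue. \<bar>(u s p - u t p) / (s - t) - u' t p\<bar>)"
        by (intro set_integral_mult_bounded Omega_sets continuous_lebesgue_measurable w B set_integral_diff(1) q int t)
      finally show ?thesis by (simp add: L1_norm_def)
    qed
    then show "\<forall>\<^sub>F s in at t within {0..T}. norm ((?m s - ?m t) / (s - t) - ?d) \<le> B * L1_norm (\<lambda>p. (u s p - u t p) / (s - t) - u' t p)"
      by (auto simp: eventually_at_filter)
  qed
  then show ?thesis
    unfolding has_field_derivative_iff by (simp add: LIM_zero_iff)
qed

text \<open>By Green's formula the moment satisfies \<open>m' = lam m + c phi\<close>, which the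
  factor \<open>exp (- lam * s)\<close> integrates. The equation holds only for almost every time,
  but \<open>m\<close> is differentiable at every time, so no absolute continuity argument is called
  for.\<close>

lemma moment_Duhamel:
  assumes T: "T > 0" and phi: "set_integrable lebesgue {0<..<T} phi" and g: "set_integrable lebesgue Omega g" and sol: "is_solution T phi g u f"
    and t: "t \<in> {0..T}" and lam: "lam = a\<^sup>2 - (real n * pi)\<^sup>2"
  shows "exp (- lam * t) * (LINT p:Omega|lebesgue. u t p * wave a n p) - (LINT p:Omega|lebesgue. g p * wave a n p)
     = (LINT p:Omega|lebesgue. f p * wave a n p) * (LINT s:{0<..<t}|lebesgue. exp (- lam * s) * phi s)"
proof -
  obtain u' ux uy uxx uxy uyx uyy where C1: "C1_L1 T u u'" and H2: "L2_H2 T u ux uy uxx uxy uyx uyy"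
    and eqn: "AE t in lebesgue. t \<in> {0<..<T} \<longrightarrow>
           (AE p in lebesgue. p \<in> Omega \<longrightarrow> u' t p - (uxx t p + uyy t p) = phi t * f p)"
    and tr: "AE t in lebesgue. t \<in> {0<..<T} \<longrightarrow>
           trace0_x0 (ux t) \<and> trace0_x1 (ux t) \<and> trace0_y0 (uy t) \<and> trace0_y1 (uy t) \<and> trace0_x1 (u t)"
    and ini: "AE p in lebesgue. p \<in> Omega \<longrightarrow> u 0 p = g p"
    using sol unfolding is_solution_def by blast
  have f: "set_integrable lebesgue Omega f"
    using sol unfolding is_solution_def by (auto intro: L2_on_Omega_imp_integrable)
  have uint: "set_integrable lebesgue Omega (u s)" "set_integrable lebesgue Omega (u' s)" if "s \<in> {0..T}" for s
    using C1 that by (auto simp: C1_L1_def L1_on_def)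
  define m where "m = (\<lambda>s. LINT p:Omega|lebesgue. u s p * wave a n p)"
  define m' where "m' = (\<lambda>s. LINT p:Omega|lebesgue. u' s p * wave a n p)"
  define c where "c = (LINT p:Omega|lebesgue. f p * wave a n p)"
  have cong: "(LINT p:Omega|lebesgue. v p * wave a n p) = (LINT p:Omega|lebesgue. v' p * wave a n p)"
    if vv': "set_integrable lebesgue Omega v" "set_integrable lebesgue Omega v'"
      and ae: "AE p in lebesgue. p \<in> Omega \<longrightarrow> v p = v' p" for v v'
  proof -
    have meas: "(\<lambda>p. indicat_real Omega p *\<^sub>R (v p * wave a n p)) \<in> borel_measurable lebesgue"
      if "set_integrable lebesgue Omega v" for v
      using set_integrable_mult_continuous[OF that wave_continuous] unfolding set_integrable_def by (rule borel_measurable_integrable)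
    have "AE p in lebesgue. indicat_real Omega p *\<^sub>R (v p * wave a n p) = indicat_real Omega p *\<^sub>R (v' p * wave a n p)"
      using ae by eventually_elim (auto simp: indicator_def)
    then show ?thesis
      unfolding set_lebesgue_integral_def by (intro integral_cong_AE meas vv')
  qed
  have ode: "AE s in lebesgue. s \<in> {0<..<T} \<longrightarrow> m' s - lam * m s = phi s * c"
    using eqn tr H2[unfolded L2_H2_def, THEN conjunct2]
  proof eventually_elim
    case (elim s)
    show ?case
    proof
      assume s: "s \<in> {0<..<T}"
      then have h2: "in_H2 (u s) (ux s) (uy s) (uxx s) (uxy s) (uyx s) (uyy s)" using elim by auto
      then have int: "set_integrable lebesgue Omega (uxx s)" "set_integrable lebesgue Omega (uyy s)"
        by (auto simp: in_H2_def in_H1_def intro: L2_on_Omega_imp_integrable)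
      have "AE p in lebesgue. p \<in> Omega \<longrightarrow> u' s p = (uxx s p + uyy s p) + phi s * f p"
        using elim s by (auto simp: algebra_simps)
      then have "m' s = (LINT p:Omega|lebesgue. ((uxx s p + uyy s p) + phi s * f p) * wave a n p)"
        unfolding m'_def using s
        by (intro cong uint set_integral_add(1) set_integrable_mult_right int f) auto
      also have "\<dots> = (LINT p:Omega|lebesgue. (uxx s p + uyy s p) * wave a n p + phi s * (f p * wave a n p))"
        by (simp only: distrib_right mult.assoc)
      also have "\<dots> = (LINT p:Omega|lebesgue. (uxx s p + uyy s p) * wave a n p) + (LINT p:Omega|lebesgue. phi s * (f p * wave a n p))"
        by (intro set_integral_add(2) set_integrable_mult_right set_integrable_mult_continuous set_integral_add(1) int f wave_continuous)
      also have "(LINT p:Omega|lebesgue. (uxx s p + uyy s p) * wave a n p) = lam * m s"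
        unfolding lam m_def by (rule Green_wave[OF h2]) (use elim s in auto)
      finally show "m' s - lam * m s = phi s * c" by (simp add: c_def)
    qed
  qed
  have deriv: "((\<lambda>s. exp (- lam * s) * m s) has_real_derivative exp (- lam * s) * (m' s - lam * m s)) (at s within {0..t})"
    if s: "s \<in> {0..t}" for s
  proof -
    have "(m has_real_derivative m' s) (at s within {0..T})"
      using C1_L1_moment_derivative[OF C1 wave_continuous, of s a n] s t unfolding m_def m'_def by auto
    then have "(m has_real_derivative m' s) (at s within {0..t})"
      by (rule has_field_derivative_subset) (use t in auto)
    then show ?thesis
      by (auto intro!: derivative_eq_intros simp: algebra_simps)
  qed
  \<comment> \<open>The gauge integral recovers a function from a derivative that exists everywhere;
    integrability of that derivative is part of the conclusion.\<close>
  have ftc: "((\<lambda>s. exp (- lam * s) * (m' s - lam * m s)) has_integral (exp (- lam * t) * m t - exp (- lam * 0) * m 0)) {0..t}"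
    using t deriv by (intro fundamental_theorem_of_calculus)
      (auto simp: has_real_derivative_iff_has_vector_derivative[symmetric])
  obtain N where N: "N \<in> null_sets lebesgue" "{s. \<not> (s \<in> {0<..<T} \<longrightarrow> m' s - lam * m s = phi s * c)} \<subseteq> N"
    using ode unfolding eventually_ae_filter by auto
  \<comment> \<open>The end points join the exceptional set because the equation is stated on the
    open interval.\<close>
  have "negligible (N \<union> {0, T})"
    using N by (intro negligible_Un) (auto simp: negligible_iff_null_sets)
  then have "((\<lambda>s. c * (exp (- lam * s) * phi s)) has_integral (exp (- lam * t) * m t - m 0)) {0..t}"
  proof (rule has_integral_spike)
    show "((\<lambda>s. exp (- lam * s) * (m' s - lam * m s)) has_integral (exp (- lam * t) * m t - m 0)) {0..t}"
      using ftc by simp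
    fix s assume "s \<in> {0..t} - (N \<union> {0, T})"
    then have "s \<in> {0<..<T}" "s \<notin> N" using t by auto
    then have "m' s - lam * m s = phi s * c" using N(2) by blast
    then show "c * (exp (- lam * s) * phi s) = exp (- lam * s) * (m' s - lam * m s)" by simp
  qed
  \<comment> \<open>The same gauge integral, now identified with a Lebesgue integral. The majorant
    \<open>exp (|lam| t)\<close> allows \<open>lam\<close> of either sign.\<close>
  moreover have "((\<lambda>s. c * (exp (- lam * s) * phi s)) has_integral (c * (LINT s:{0<..<t}|lebesgue. exp (- lam * s) * phi s))) {0..t}"
  proof -
    have "set_integrable lebesgue {0<..<t} phi"
      by (rule set_integrable_subset[OF phi]) (use t in auto)
    then have "set_integrable lebesgue {0<..<t} (\<lambda>s. phi s * exp (- lam * s))"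
    proof (rule set_integrable_mult_bounded)
      show "(\<lambda>s. exp (- lam * s)) \<in> borel_measurable lebesgue"
        by (intro borel_measurable_lebesgueI borel_measurable_continuous_onI continuous_intros)
      show "\<bar>exp (- lam * s)\<bar> \<le> exp (\<bar>lam\<bar> * t)" if "s \<in> {0<..<t}" for s
      proof -
        have "- lam * s \<le> \<bar>lam\<bar> * s" using that by (intro mult_right_mono) auto
        also have "\<dots> \<le> \<bar>lam\<bar> * t" using that by (intro mult_left_mono) auto
        finally show ?thesis by simp
      qed
    qed auto
    then have "(\<lambda>s. exp (- lam * s) * phi s) absolutely_integrable_on {0<..<t}"
      by (simp add: mult.commute)
    from has_integral_set_lebesgue[OF this]
    have "((\<lambda>s. exp (- lam * s) * phi s) has_integral (LINT s:{0<..<t}|lebesgue. exp (- lam * s) * phi s)) {0..t}"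
      by (simp add: has_integral_Icc_iff_Ioo)
    then show ?thesis by (rule has_integral_mult_right)
  qed
  ultimately have "exp (- lam * t) * m t - m 0 = c * (LINT s:{0<..<t}|lebesgue. exp (- lam * s) * phi s)"
    by (rule has_integral_unique)
  moreover have "m 0 = (LINT p:Omega|lebesgue. g p * wave a n p)"
    unfolding m_def by (rule cong[OF uint(1) g ini]) (use T in auto)
  ultimately show ?thesis by (simp add: m_def c_def)
qed

section \<open>Lower bound for the Laplace integral of the time factor\<close>

text \<open>With \<open>d = T0 / 2\<close>, the window \<open>(d/2, d)\<close> alone contributes at
  least \<open>L * (d / 2) * exp (- lam * d)\<close>. Beyond \<open>T0\<close> the sign of
  \<open>phi\<close> is unknown, but the loss is at most \<open>M * exp (- 2 * lam * d)\<close>, of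
  smaller order.\<close>

lemma Laplace_lower_bound:
  fixes phi :: "real \<Rightarrow> real"
  assumes phi: "set_integrable lebesgue {0<..<T} phi" and T0: "0 < T0" "T0 \<le> T"
    and th: "\<theta> \<ge> 0" "\<Lambda> > 0"
    and low: "AE t in lebesgue. t \<in> {0<..<T0} \<longrightarrow> phi t \<ge> \<Lambda> * t powr \<theta>"
  shows "\<exists>K>0. \<forall>\<^sub>F lam in at_top. K * exp (- lam * (T0 / 2)) \<le> (LINT s:{0<..<T}|lebesgue. exp (- lam * s) * phi s)"
proof -
  define d where "d = T0 / 2"
  define L where "L = \<Lambda> * (d / 2) powr \<theta>"
  define M where "M = (LINT s:{0<..<T}|lebesgue. \<bar>phi s\<bar>)"
  have d: "d > 0" "T0 = 2 * d" "d < T" using T0 by (auto simp: d_def)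
  have L: "L > 0" using th d by (simp add: L_def)
  have bound: "L * (d / 2) * exp (- lam * d) - exp (- lam * T0) * M \<le> (LINT s:{0<..<T}|lebesgue. exp (- lam * s) * phi s)"
    if lam: "lam \<ge> 0" for lam
  proof -
    have "{0<..<T} \<inter> {d/2<..<d} \<in> lmeasurable"
      by (intro bounded_set_imp_lmeasurable bounded_Int) auto
    then have i1: "set_integrable lebesgue {0<..<T} (indicat_real {d/2<..<d})"
      unfolding set_integrable_def real_scaleR_def indicator_inter_arith[symmetric]
      by (intro integrable_real_indicator) (auto simp: fmeasurable_def)
    \<comment> \<open>One comparison function for all of \<open>(0,T)\<close>: the bound for the
      part beyond \<open>T0\<close> is subtracted everywhere, which on \<open>(0,T0)\<close> only
      lowers it.\<close>
    have int_lhs: "set_integrable lebesgue {0<..<T} (\<lambda>s. L * exp (- lam * d) * indicator {d/2<..<d} s - exp (- lam * T0) * \<bar>phi s\<bar>)"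
      by (intro set_integral_diff(1) set_integrable_mult_right set_integrable_abs phi i1)
    have int_rhs: "set_integrable lebesgue {0<..<T} (\<lambda>s. exp (- lam * s) * phi s)"
    proof -
      have "set_integrable lebesgue {0<..<T} (\<lambda>s. phi s * exp (- lam * s))"
        by (rule set_integrable_mult_bounded[OF phi, of _ 1])
          (use lam in \<open>auto intro!: borel_measurable_lebesgueI borel_measurable_continuous_onI continuous_intros\<close>)
      then show ?thesis by (simp add: mult.commute)
    qed
    have "(LINT s:{0<..<T}|lebesgue. L * exp (- lam * d) * indicator {d/2<..<d} s - exp (- lam * T0) * \<bar>phi s\<bar>)
       \<le> (LINT s:{0<..<T}|lebesgue. exp (- lam * s) * phi s)"
    proof (rule set_integral_mono_AE[OF int_lhs int_rhs])
      show "AE s\<in>{0<..<T} in lebesgue. L * exp (- lam * d) * indicator {d/2<..<d} s - exp (- lam * T0) * \<bar>phi s\<bar> \<le> exp (- lam * s) * phi s"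
        using low
      proof eventually_elim
        case (elim s)
        show ?case
        proof
          assume s: "s \<in> {0<..<T}"
          have nn: "0 \<le> exp (- lam * T0) * \<bar>phi s\<bar>" by simp
          show "L * exp (- lam * d) * indicator {d/2<..<d} s - exp (- lam * T0) * \<bar>phi s\<bar> \<le> exp (- lam * s) * phi s"
          proof (cases "s < T0")
            case True
            then have ps: "phi s \<ge> \<Lambda> * s powr \<theta>" using elim s by auto
            then have p0: "phi s \<ge> 0" using th by (meson less_imp_le mult_nonneg_nonneg order_trans powr_ge_zero)
            show ?thesis
            proof (cases "s \<in> {d/2<..<d}")
              case in_d: True
              have "L \<le> \<Lambda> * s powr \<theta>"
                unfolding L_def using in_d d th by (intro mult_left_mono powr_mono2) auto
              then have 1: "L \<le> phi s" using ps by linarith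
              have 2: "exp (- lam * d) \<le> exp (- lam * s)" using in_d lam by (auto intro: mult_left_mono)
              have "L * exp (- lam * d) \<le> phi s * exp (- lam * s)"
                using 1 2 L by (intro mult_mono) auto
              then show ?thesis using in_d nn by (simp only: indicator_simps mult_1_right mult.commute[of "phi s"])
            next
              case False
              have "0 \<le> exp (- lam * s) * phi s" using p0 by simp
              then show ?thesis using nn unfolding indicator_simps(2)[OF False] by linarith
            qed
          next
            case False
            then have "s \<notin> {d/2<..<d}" using d by auto
            moreover have "exp (- lam * s) * \<bar>phi s\<bar> \<le> exp (- lam * T0) * \<bar>phi s\<bar>"
              using False lam by (intro mult_right_mono) (auto intro: mult_left_mono)
            moreover have "- (exp (- lam * s) * \<bar>phi s\<bar>) \<le> exp (- lam * s) * phi s"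
            proof -
              have "exp (- lam * s) * (- \<bar>phi s\<bar>) \<le> exp (- lam * s) * phi s" by (intro mult_left_mono) auto
              then show ?thesis by simp
            qed
            ultimately show ?thesis by simp
          qed
        qed
      qed
    qed
    also have "(LINT s:{0<..<T}|lebesgue. L * exp (- lam * d) * indicator {d/2<..<d} s - exp (- lam * T0) * \<bar>phi s\<bar>)
      = L * exp (- lam * d) * (d / 2) - exp (- lam * T0) * M"
    proof -
      have "(LINT s:{0<..<T}|lebesgue. indicat_real {d/2<..<d} s) = (LINT s|lebesgue. indicat_real {d/2<..<d} s)"
        unfolding set_lebesgue_integral_def using d by (intro Bochner_Integration.integral_cong) (auto simp: indicator_def)
      also have "\<dots> = d / 2" using d by simp
      finally have "(LINT s:{0<..<T}|lebesgue. indicat_real {d/2<..<d} s) = d / 2" .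
      then show ?thesis
        by (subst set_integral_diff(2)) (auto simp: M_def intro!: set_integrable_mult_right set_integrable_abs phi i1)
    qed
    finally show ?thesis by (simp add: mult_ac)
  qed
  \<comment> \<open>Half of the main coefficient; the other half absorbs the part beyond
    \<open>T0\<close> once \<open>lam\<close> is large.\<close>
  define K where "K = L * (d / 2) / 2"
  have K: "K > 0" using L d by (simp add: K_def)
  have "((\<lambda>lam. exp (- (lam * d)) * M) \<longlongrightarrow> 0 * M) at_top"
  proof (intro tendsto_mult tendsto_const filterlim_compose[OF exp_at_bot])
    have "filterlim (\<lambda>lam. lam * d) at_top at_top"
      using d by (intro filterlim_at_top_mult_tendsto_pos[where c=d] tendsto_const filterlim_ident)
    then show "filterlim (\<lambda>lam. - (lam * d)) at_bot at_top" by (simp add: filterlim_uminus_at_top)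
  qed
  then have "\<forall>\<^sub>F lam in at_top. exp (- (lam * d)) * M < K"
    using K by (intro order_tendstoD(2)) auto
  then have "\<forall>\<^sub>F lam in at_top. K * exp (- lam * (T0 / 2)) \<le> (LINT s:{0<..<T}|lebesgue. exp (- lam * s) * phi s)"
    using eventually_ge_at_top[of 0]
  proof eventually_elim
    case (elim lam)
    have "exp (- lam * T0) = exp (- lam * d) * exp (- lam * d)"
      unfolding d(2) mult_exp_exp by simp
    then have "exp (- lam * T0) * M = exp (- lam * d) * (exp (- (lam * d)) * M)" by simp
    also have "\<dots> \<le> exp (- lam * d) * K" using elim by (intro mult_left_mono) auto
    finally have "K * exp (- lam * d) \<le> L * (d / 2) * exp (- lam * d) - exp (- lam * T0) * M"
      by (simp add: K_def algebra_simps)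
    also have "\<dots> \<le> (LINT s:{0<..<T}|lebesgue. exp (- lam * s) * phi s)" by (rule bound) fact
    finally show ?case by (simp add: d_def)
  qed
  with K show ?thesis by blast
qed

text \<open>The second alternative of (H) is the first for \<open>- phi\<close>, which explains the
  absolute value. Passing from \<open>T0\<close> to \<open>T\<close> weakens the rate, but
  \<open>T / 2\<close> still beats the factor \<open>exp (- lam * T)\<close> in the moment
  identity.\<close>

lemma cond_H_Laplace_lower_bound:
  assumes phi: "set_integrable lebesgue {0<..<T} phi" and H: "cond_H T phi"
  shows "\<exists>K>0. \<forall>\<^sub>F lam in at_top. K * exp (- lam * (T / 2)) \<le> \<bar>LINT s:{0<..<T}|lebesgue. exp (- lam * s) * phi s\<bar>"
proof -
  obtain T0 th L where T0: "0 < T0" "T0 \<le> T" and th: "th \<ge> 0" "L > 0"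
    and alt: "(AE t in lebesgue. t \<in> {0<..<T0} \<longrightarrow> phi t \<ge> L * t powr th) \<or>
      (AE t in lebesgue. t \<in> {0<..<T0} \<longrightarrow> phi t \<le> - L * t powr th)"
    using H unfolding cond_H_def by blast
  have "\<exists>K>0. \<forall>\<^sub>F lam in at_top. K * exp (- lam * (T0 / 2)) \<le> \<bar>LINT s:{0<..<T}|lebesgue. exp (- lam * s) * phi s\<bar>"
    using alt
  proof
    assume "AE t in lebesgue. t \<in> {0<..<T0} \<longrightarrow> phi t \<ge> L * t powr th"
    from Laplace_lower_bound[OF phi T0 th this] obtain K where "K > 0"
      and "\<forall>\<^sub>F lam in at_top. K * exp (- lam * (T0 / 2)) \<le> (LINT s:{0<..<T}|lebesgue. exp (- lam * s) * phi s)"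
      by blast
    then show ?thesis by (intro exI[of _ K] conjI) (auto elim!: eventually_mono)
  next
    assume "AE t in lebesgue. t \<in> {0<..<T0} \<longrightarrow> phi t \<le> - L * t powr th"
    then have ae: "AE t in lebesgue. t \<in> {0<..<T0} \<longrightarrow> - phi t \<ge> L * t powr th"
      by eventually_elim auto
    have "set_integrable lebesgue {0<..<T} (\<lambda>s. -1 * phi s)"
      by (intro set_integrable_mult_right phi)
    then have "set_integrable lebesgue {0<..<T} (\<lambda>s. - phi s)" by simp
    from Laplace_lower_bound[OF this T0 th ae] obtain K where K: "K > 0"
      and ev: "\<forall>\<^sub>F lam in at_top. K * exp (- lam * (T0 / 2)) \<le> (LINT s:{0<..<T}|lebesgue. exp (- lam * s) * - phi s)"
      by blast
    have le: "(LINT s:{0<..<T}|lebesgue. exp (- lam * s) * - phi s) \<le> \<bar>LINT s:{0<..<T}|lebesgue. exp (- lam * s) * phi s\<bar>" for lam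
    proof -
      have "(LINT s:{0<..<T}|lebesgue. exp (- lam * s) * - phi s) = - (LINT s:{0<..<T}|lebesgue. exp (- lam * s) * phi s)"
        unfolding set_lebesgue_integral_def by simp
      then show ?thesis by linarith
    qed
    from ev have "\<forall>\<^sub>F lam in at_top. K * exp (- lam * (T0 / 2)) \<le> \<bar>LINT s:{0<..<T}|lebesgue. exp (- lam * s) * phi s\<bar>"
    proof eventually_elim
      case (elim lam)
      with le[of lam] show ?case by linarith
    qed
    with K show ?thesis by blast
  qed
  then obtain K where K: "K > 0"
    and ev: "\<forall>\<^sub>F lam in at_top. K * exp (- lam * (T0 / 2)) \<le> \<bar>LINT s:{0<..<T}|lebesgue. exp (- lam * s) * phi s\<bar>"
    by blast
  have "\<forall>\<^sub>F lam in at_top. K * exp (- lam * (T / 2)) \<le> \<bar>LINT s:{0<..<T}|lebesgue. exp (- lam * s) * phi s\<bar>"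
    using ev eventually_ge_at_top[of 0]
  proof eventually_elim
    case (elim lam)
    have "K * exp (- lam * (T / 2)) \<le> K * exp (- lam * (T0 / 2))"
      using K elim T0 by (intro mult_left_mono) (auto intro: mult_left_mono)
    with elim show ?case by linarith
  qed
  with K show ?thesis by blast
qed

section \<open>Uniqueness of the pair\<close>

theorem theorem1:
  fixes T :: real and phi :: "real \<Rightarrow> real" and g :: "(real \<times> real) \<Rightarrow> real"
    and u1 u2 :: "real \<Rightarrow> (real \<times> real) \<Rightarrow> real" and f1 f2 :: "(real \<times> real) \<Rightarrow> real"
  assumes "T > 0"
    and "L1_on Omega g"
    and "L1_on {0<..<T} phi"
    and "cond_H T phi"
    and "is_solution T phi g u1 f1"
    and "is_solution T phi g u2 f2"
  shows "(\<forall>t\<in>{0..T}. AE p in lebesgue. p \<in> Omega \<longrightarrow> u1 t p = u2 t p) \<and>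
         (AE p in lebesgue. p \<in> Omega \<longrightarrow> f1 p = f2 p)"
proof -
  have phi: "set_integrable lebesgue {0<..<T} phi" and g: "set_integrable lebesgue Omega g"
    using assms by (simp_all add: L1_on_def)
  have f: "set_integrable lebesgue Omega f1" "set_integrable lebesgue Omega f2"
    using assms(5,6) unfolding is_solution_def by (auto intro: L2_on_Omega_imp_integrable)
  have u: "set_integrable lebesgue Omega (u1 t)" "set_integrable lebesgue Omega (u2 t)" if "t \<in> {0..T}" for t
    using assms(5,6) that unfolding is_solution_def C1_L1_def L1_on_def by auto
  have wave_diff: "(LINT p:Omega|lebesgue. (v1 p - v2 p) * wave a n p)
      = (LINT p:Omega|lebesgue. v1 p * wave a n p) - (LINT p:Omega|lebesgue. v2 p * wave a n p)"
    if "set_integrable lebesgue Omega v1" "set_integrable lebesgue Omega v2" for v1 v2 a n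
    unfolding left_diff_distrib by (intro set_integral_diff(2) set_integrable_mult_continuous wave_continuous that)
  define Phi where "Phi = (\<lambda>lam t. LINT s:{0<..<t}|lebesgue. exp (- lam * s) * phi s)"
  \<comment> \<open>The moment identities of the two solutions are subtracted, and the common
    initial moment of \<open>g\<close> cancels. Working with moments avoids showing that the
    difference solves the homogeneous system.\<close>
  have key: "exp (- (a\<^sup>2 - (real n * pi)\<^sup>2) * t) * (LINT p:Omega|lebesgue. (u1 t p - u2 t p) * wave a n p)
      = (LINT p:Omega|lebesgue. (f1 p - f2 p) * wave a n p) * Phi (a\<^sup>2 - (real n * pi)\<^sup>2) t" if t: "t \<in> {0..T}" for t a n
    using moment_Duhamel[OF assms(1) phi g assms(5) t refl, of a n] moment_Duhamel[OF assms(1) phi g assms(6) t refl, of a n]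
    unfolding wave_diff[OF u[OF t]] wave_diff[OF f] Phi_def by (simp add: algebra_simps)
  obtain K where K: "K > 0" and low: "\<forall>\<^sub>F lam in at_top. K * exp (- lam * (T / 2)) \<le> \<bar>Phi lam T\<bar>"
    using cond_H_Laplace_lower_bound[OF phi assms(4)] unfolding Phi_def by blast
  have f_eq: "AE p in lebesgue. p \<in> Omega \<longrightarrow> f1 p - f2 p = 0"
  proof (rule cosh_cos_moments_small_imp_AE_zero)
    show "set_integrable lebesgue Omega (\<lambda>p. f1 p - f2 p)" by (intro set_integral_diff(1) f)
    fix n :: nat
    define b where "b = real n * pi"
    define M where "M = (LINT p:Omega|lebesgue. \<bar>u1 T p - u2 T p\<bar>)"
    have TT: "T \<in> {0..T}" using assms(1) by auto
    have lam_top: "filterlim (\<lambda>a::real. a\<^sup>2 - b\<^sup>2) at_top at_top"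
      using filterlim_tendsto_add_at_top[OF tendsto_const[of "- b\<^sup>2"] filterlim_pow_at_top[OF _ filterlim_ident, of 2]] by simp
    \<comment> \<open>Prepares the final estimate, which gains two factors \<open>exp (- a)\<close>:
      one absorbs the constant \<open>M / K * exp (b^2 * T / 2)\<close>, the other is the bound
      claimed.\<close>
    have "((\<lambda>a. M / K * exp (b\<^sup>2 * T / 2) * exp (- a)) \<longlongrightarrow> M / K * exp (b\<^sup>2 * T / 2) * 0) at_top"
      by (intro tendsto_mult tendsto_const filterlim_compose[OF exp_at_bot filterlim_uminus_at_bot_at_top])
    then have "\<forall>\<^sub>F a in at_top. M / K * exp (b\<^sup>2 * T / 2) * exp (- a) < 1"
      by (intro order_tendstoD(2)) auto
    then show "\<forall>\<^sub>F a in at_top. \<bar>LINT p:Omega|lebesgue. (f1 p - f2 p) * (cosh (a * fst p) * cos (real n * pi * snd p))\<bar> \<le> exp (- a)"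
      using eventually_compose_filterlim[OF low lam_top] eventually_ge_at_top[of "6 / T"] eventually_ge_at_top[of 0]
    proof eventually_elim
      case (elim a)
      define lam where "lam = a\<^sup>2 - b\<^sup>2"
      define c where "c = (LINT p:Omega|lebesgue. (f1 p - f2 p) * wave a n p)"
      have "\<bar>LINT p:Omega|lebesgue. (u1 T p - u2 T p) * wave a n p\<bar> \<le> exp a * M"
        unfolding M_def
      proof (intro set_integral_mult_bounded Omega_sets set_integral_diff(1) u TT continuous_lebesgue_measurable wave_continuous)
        show "\<bar>wave a n p\<bar> \<le> exp a" if "p \<in> Omega" for p
        proof -
          have "\<bar>a * fst p\<bar> \<le> a" using that elim by (auto simp: Omega_def abs_mult mult_left_le)
          then have "cosh (a * fst p) * \<bar>cos (real n * pi * snd p)\<bar> \<le> exp a * 1"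
            by (intro mult_mono cosh_le_exp) auto
          then show ?thesis by (simp add: wave_def abs_mult)
        qed
      qed
      then have "exp (- lam * T) * \<bar>LINT p:Omega|lebesgue. (u1 T p - u2 T p) * wave a n p\<bar> \<le> exp (- lam * T) * (exp a * M)"
        by (intro mult_left_mono) auto
      moreover have "\<bar>c\<bar> * \<bar>Phi lam T\<bar> = exp (- lam * T) * \<bar>LINT p:Omega|lebesgue. (u1 T p - u2 T p) * wave a n p\<bar>"
        using arg_cong[OF key[OF TT, of a n], of abs] by (simp add: abs_mult c_def lam_def b_def)
      moreover have "\<bar>c\<bar> * (K * exp (- lam * (T / 2))) \<le> \<bar>c\<bar> * \<bar>Phi lam T\<bar>"
        using elim by (intro mult_left_mono) (auto simp: lam_def)
      ultimately have "\<bar>c\<bar> * (K * exp (- lam * (T / 2))) \<le> exp (- lam * T) * (exp a * M)" by linarith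
      \<comment> \<open>Split in two equal factors, one of which cancels against the lower bound for
        \<open>Phi\<close>.\<close>
      moreover have "exp (- lam * T) = exp (- lam * (T / 2)) * exp (- lam * (T / 2))"
        unfolding mult_exp_exp by simp
      ultimately have "(\<bar>c\<bar> * K) * exp (- lam * (T / 2)) \<le> (exp (- lam * (T / 2)) * exp a * M) * exp (- lam * (T / 2))"
        by (simp only: mult_ac)
      then have "\<bar>c\<bar> * K \<le> exp (- lam * (T / 2)) * exp a * M"
        by (rule mult_right_le_imp_le) simp
      then have "\<bar>c\<bar> \<le> M / K * (exp (- lam * (T / 2)) * exp a)"
        using K by (simp add: field_simps)
      also have "\<dots> \<le> M / K * (exp (b\<^sup>2 * T / 2) * exp (- a) * exp (- a))"
      proof (intro mult_left_mono)
        \<comment> \<open>The threshold \<open>6 / T\<close> gives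
          \<open>a^2 * T / 2 \<ge> 3 * a\<close>: one \<open>a\<close> compensates the growth
          \<open>exp a\<close> of the weight and two are left over.\<close>
        have "6 \<le> a * T" using elim assms(1) by (simp add: field_simps)
        then have "a * 6 \<le> a * (a * T)" using elim by (intro mult_left_mono) auto
        then have "- lam * (T / 2) + a \<le> b\<^sup>2 * T / 2 + (- a) + (- a)"
          by (simp add: lam_def power2_eq_square algebra_simps)
        then show "exp (- lam * (T / 2)) * exp a \<le> exp (b\<^sup>2 * T / 2) * exp (- a) * exp (- a)"
          unfolding mult_exp_exp by simp
        have "0 \<le> M" unfolding M_def set_lebesgue_integral_def by (intro Bochner_Integration.integral_nonneg) auto
        then show "0 \<le> M / K" using K by simp
      qed
      also have "\<dots> = (M / K * exp (b\<^sup>2 * T / 2) * exp (- a)) * exp (- a)" by simp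
      also have "\<dots> \<le> 1 * exp (- a)" using elim by (intro mult_right_mono) auto
      finally show ?case by (simp add: c_def wave_def)
    qed
  qed
  have c0: "(LINT p:Omega|lebesgue. (f1 p - f2 p) * wave a n p) = 0" for a n
  proof -
    have "AE p in lebesgue. indicat_real Omega p *\<^sub>R ((f1 p - f2 p) * wave a n p) = 0"
      using f_eq by eventually_elim (auto simp: indicator_def)
    then show ?thesis unfolding set_lebesgue_integral_def by (rule integral_eq_zero_AE)
  qed
  have u_eq: "AE p in lebesgue. p \<in> Omega \<longrightarrow> u1 t p - u2 t p = 0" if t: "t \<in> {0..T}" for t
  proof (rule cosh_cos_moments_small_imp_AE_zero)
    show "set_integrable lebesgue Omega (\<lambda>p. u1 t p - u2 t p)" by (intro set_integral_diff(1) u t)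
    \<comment> \<open>With the moments of \<open>f1 - f2\<close> equal to zero, \<open>key\<close>
      makes those of \<open>u1 t - u2 t\<close> vanish exactly for every \<open>a\<close>; the decay
      asked for is then immediate.\<close>
    show "\<forall>\<^sub>F a in at_top. \<bar>LINT p:Omega|lebesgue. (u1 t p - u2 t p) * (cosh (a * fst p) * cos (real n * pi * snd p))\<bar> \<le> exp (- a)" for n :: nat
      using key[OF t, of _ n] unfolding c0 by (simp add: wave_def)
  qed
  show ?thesis
    using f_eq u_eq by simp
qed

end
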